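(* Let $a_1,a_2\in\mathbb{C}\setminus\{0\}$ and let $q=q(x)$ be a $\mathrm{P}_{\mathrm{II}}$ transcendent, i.e. a solution of $q''=2q^3+xq+\alpha$ with $\alpha\in\mathbb{C}$. Then the modified system XIII depending on $a_1,a_2$, given by $$\begin{cases} y'=\dfrac{a_1}{a_2}\left(2q^2+2q'+x\right)-\dfrac{a_2}{a_1}\,y^2+3\,a_1\,y\,z+4\,y\,q,\\[2ex] z'=z\left(\dfrac{a_2}{a_1}\,y-a_1\,z-2q\right),\end{cases}$$ is a Bureau-Guillot system (an analogue of the Bureau-Guillot system) for the second Painlevé equation $(\mathrm{P}_{\mathrm{II}})$.
   Context: The independent variable is $x\in\mathbb{C}$ and $'=d/dx$. $(\mathrm{P}_{\mathrm{II}})\colon y''=2y^3+xy+\alpha$. The Hamiltonian system with coefficients rational in $x$ associated with $(\mathrm{P}_{\mathrm{II}})$ is (system IX.B(3)) $$y_{93}'=z_{93}-y_{93}^2-\tfrac{x}{2},\qquad z_{93}'=2\,y_{93}z_{93}+\alpha+\tfrac12,$$ in which $y_{93}$ satisfies $(\mathrm{P}_{\mathrm{II}})$. Regularisation process. A system $y'=P(y,z;x)$, $z'=Q(y,z;x)$, with $P,Q$ rational in $(y,z)$ and coefficients depending on $x$, is extended to $\mathbb{P}^2$, covered by the affine charts $(y,z)$, $(u_0,v_0)$, $(U_0,V_0)$ with $[1:y:z]=[u_0:1:v_0]=[V_0:U_0:1]$. In each chart one looks for base points, i.e. points where the right-hand side of one of the (rational) equations becomes $0/0$. Each base point (in a chart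 $(y,z)$, at $(a,b)$) is blown up, by introducing the charts $u=y-a$, $v=\frac{z-b}{y-a}$ and $U=\frac{y-a}{z-b}$, $V=z-b$, with exceptional curve $\{u=0\}\cup\{V=0\}$; new base points on it are blown up again, which gives for each base point one or more finite sequences ("cascades") of blow-ups, until no indeterminacy is left in the final charts. The system is regularised if in every cascade it is regular on the last exceptional curve in one of the final charts. The regularising conditions are the (differential) constraints on the coefficient functions of the system which make it regular on the last exceptional curves in this sense. Definition. A system $y'=P(y,z;x)$, $z'=Q(y,z;x)$ is an analogue of the Bureau-Guillot system (Bureau-Guillot, for short) for $(\mathrm{P}_{\mathrm J})$ if: (i) it is birationally equivalent (by a transformation of $(y,z)$ with coefficients depending on $x$) to the Hamiltonian system with coefficients rational in $x$ associated with $(\mathrm{P}_{\mathrm J})$; (ii) it has coefficient functions both rational and meromorphic in $x$ which are functions of the Painlevé transcendent $\mathrm{P}_{\mathrm J}$ (here $q$) and its derivatives; (iii) the Painlevé equation $(\mathrm{P}_{\mathrm J})$ is obtained as a regularising condition in the regularisation process of the system, i.e., regarding $q$ as an a priori undetermined function, the regularising conditions are differential equations for $q$ that are satisfied when $q$ solves $(\mathrm{P}_{\mathrm J})$. *)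

theory Defs
  imports "HOL-Complex_Analysis.Complex_Analysis" "HOL-Computational_Algebra.Computational_Algebra"
begin

section \<open>Planar rational systems over a differential field\<close>

text \<open>
  The coefficients, functions of \<open>x\<close>, live in a field \<open>'k\<close> with a derivation \<open>\<delta> = d/dx\<close>.
  The field of rational functions in two variables \<open>y, z\<close> over \<open>'k\<close> is \<open>'k poly poly fract\<close>:
  the inner polynomial variable is \<open>y\<close> and the outer one is \<open>z\<close>.
\<close>

type_synonym 'k ratfun = "'k poly poly fract"

text \<open>The pair \<open>(P, Q)\<close> stands for the system \<open>y' = P(y,z)\<close>, \<open>z' = Q(y,z)\<close>.\<close>
type_synonym 'k system = "'k ratfun \<times> 'k ratfun"

definition cst :: "'k::field \<Rightarrow> 'k ratfun" where
  "cst k = Fract [:[:k:]:] 1"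

definition var_y :: "'k::field ratfun" where
  "var_y = Fract [:[:0, 1:]:] 1"

definition var_z :: "'k::field ratfun" where
  "var_z = Fract [:0, 1:] 1"

definition eval_at :: "'k::field poly poly \<Rightarrow> 'k \<times> 'k \<Rightarrow> 'k" where
  "eval_at p w = poly (poly p [:snd w:]) (fst w)"

definition poly_subst :: "'k::field poly poly \<Rightarrow> 'k ratfun \<Rightarrow> 'k ratfun \<Rightarrow> 'k ratfun" where
  "poly_subst p f g = poly (map_poly (\<lambda>c. poly (map_poly cst c) f) p) g"

text \<open>\<open>is_subst h f g r\<close>: the composition \<open>h(f, g)\<close> makes sense (some denominator of \<open>h\<close> does
  not vanish after the substitution \<open>y = f\<close>, \<open>z = g\<close>) and is \<open>r\<close>; \<open>r\<close> is then unique.\<close>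
definition is_subst :: "'k::field ratfun \<Rightarrow> 'k ratfun \<Rightarrow> 'k ratfun \<Rightarrow> 'k ratfun \<Rightarrow> bool" where
  "is_subst h f g r \<longleftrightarrow>
     (\<exists>n d. d \<noteq> 0 \<and> h = Fract n d \<and> poly_subst d f g \<noteq> 0 \<and>
            r = poly_subst n f g / poly_subst d f g)"

text \<open>Only used below for dominant \<open>(f, g)\<close>, for which the composition always exists.\<close>
definition subst :: "'k::field ratfun \<Rightarrow> 'k ratfun \<Rightarrow> 'k ratfun \<Rightarrow> 'k ratfun" where
  "subst h f g = (THE r. is_subst h f g r)"

text \<open>The total derivative \<open>\<partial>\<^sub>x p + P \<partial>\<^sub>y p + Q \<partial>\<^sub>z p\<close> along the system \<open>(P, Q)\<close>.\<close>
definition poly_total_deriv ::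
    "('k \<Rightarrow> 'k) \<Rightarrow> 'k::field system \<Rightarrow> 'k poly poly \<Rightarrow> 'k ratfun" where
  "poly_total_deriv \<delta> S p =
     Fract (map_poly (map_poly \<delta>) p) 1
     + fst S * Fract (map_poly pderiv p) 1
     + snd S * Fract (pderiv p) 1"

definition is_total_deriv ::
    "('k \<Rightarrow> 'k) \<Rightarrow> 'k::field system \<Rightarrow> 'k ratfun \<Rightarrow> 'k ratfun \<Rightarrow> bool" where
  "is_total_deriv \<delta> S h r \<longleftrightarrow>
     (\<exists>n d. d \<noteq> 0 \<and> h = Fract n d \<and>
            r = (poly_total_deriv \<delta> S n * Fract d 1 - Fract n 1 * poly_total_deriv \<delta> S d)
                / (Fract d 1)\<^sup>2)"

definition coeffs_in :: "'k set \<Rightarrow> 'k::field ratfun \<Rightarrow> bool" where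
  "coeffs_in M h \<longleftrightarrow>
     (\<exists>n d. d \<noteq> 0 \<and> h = Fract n d \<and>
            (\<forall>i j. coeff (coeff n i) j \<in> M \<and> coeff (coeff d i) j \<in> M))"

text \<open>The substitution \<open>y = f(\<eta>,\<zeta>)\<close>, \<open>z = g(\<eta>,\<zeta>)\<close>, with rational inverse
  \<open>\<eta> = f'(y,z)\<close>, \<open>\<zeta> = g'(y,z)\<close> and all coefficients in \<open>M\<close>, turns the system \<open>S\<close> for \<open>(y,z)\<close>
  into the system \<open>T\<close> for \<open>(\<eta>,\<zeta>)\<close>.\<close>
definition birationally_equivalent ::
    "('k \<Rightarrow> 'k) \<Rightarrow> 'k set \<Rightarrow> 'k::field system \<Rightarrow> 'k system \<Rightarrow> bool" where
  "birationally_equivalent \<delta> M S T \<longleftrightarrow>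
     (\<exists>f g f' g'.
        coeffs_in M f \<and> coeffs_in M g \<and> coeffs_in M f' \<and> coeffs_in M g' \<and>
        is_subst f f' g' var_y \<and> is_subst g f' g' var_z \<and>
        is_subst f' f g var_y \<and> is_subst g' f g var_z \<and>
        (\<exists>r. is_total_deriv \<delta> T f r \<and> is_subst (fst S) f g r) \<and>
        (\<exists>r. is_total_deriv \<delta> T g r \<and> is_subst (snd S) f g r))"


section \<open>The regularisation process\<close>

subsection \<open>Base points and regularity in a chart\<close>

text \<open>\<open>h\<close>, written in lowest terms, becomes \<open>0/0\<close> at \<open>w\<close>.\<close>
definition indeterminate_at :: "'k::field ratfun \<Rightarrow> 'k \<times> 'k \<Rightarrow> bool" where
  "indeterminate_at h w \<longleftrightarrow>
     (\<exists>n d. d \<noteq> 0 \<and> coprime n d \<and> h = Fract n d \<and> eval_at n w = 0 \<and> eval_at d w = 0)"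

definition base_point :: "'k::field system \<Rightarrow> 'k \<times> 'k \<Rightarrow> bool" where
  "base_point S w \<longleftrightarrow> indeterminate_at (fst S) w \<or> indeterminate_at (snd S) w"

definition regular_at :: "'k::field system \<Rightarrow> 'k \<times> 'k \<Rightarrow> bool" where
  "regular_at S w \<longleftrightarrow>
     (\<exists>n d. fst S = Fract n d \<and> eval_at d w \<noteq> 0) \<and>
     (\<exists>n d. snd S = Fract n d \<and> eval_at d w \<noteq> 0)"

subsection \<open>The charts of the projective plane\<close>

text \<open>In every chart the two coordinates are again called \<open>var_y\<close>, \<open>var_z\<close>.\<close>

text \<open>\<open>u\<^sub>0 = 1/y\<close>, \<open>v\<^sub>0 = z/y\<close>, hence \<open>u\<^sub>0' = - u\<^sub>0\<^sup>2 y'\<close>, \<open>v\<^sub>0' = u\<^sub>0 z' - u\<^sub>0 v\<^sub>0 y'\<close>.\<close>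
definition chart_u0v0 :: "'k::field system \<Rightarrow> 'k system" where
  "chart_u0v0 S =
     (let u = var_y; v = var_z;
          P = subst (fst S) (1 / u) (v / u); Q = subst (snd S) (1 / u) (v / u)
      in (- u\<^sup>2 * P, u * Q - u * v * P))"

text \<open>\<open>U\<^sub>0 = y/z\<close>, \<open>V\<^sub>0 = 1/z\<close>, hence \<open>U\<^sub>0' = V\<^sub>0 y' - U\<^sub>0 V\<^sub>0 z'\<close>, \<open>V\<^sub>0' = - V\<^sub>0\<^sup>2 z'\<close>.\<close>
definition chart_U0V0 :: "'k::field system \<Rightarrow> 'k system" where
  "chart_U0V0 S =
     (let U = var_y; V = var_z;
          P = subst (fst S) (U / V) (1 / V); Q = subst (snd S) (U / V) (1 / V)
      in (V * P - U * V * Q, - V\<^sup>2 * Q))"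

subsection \<open>Blow-ups\<close>

text \<open>The centre \<open>(a, b)\<close> depends on \<open>x\<close>, whence the terms \<open>\<delta> a\<close>, \<open>\<delta> b\<close>.\<close>

text \<open>\<open>y = a + u\<close>, \<open>z = b + u v\<close>; the exceptional curve is \<open>u = 0\<close>.\<close>
definition blowup_uv :: "('k \<Rightarrow> 'k) \<Rightarrow> 'k \<times> 'k \<Rightarrow> 'k::field system \<Rightarrow> 'k system" where
  "blowup_uv \<delta> w S =
     (let a = fst w; b = snd w; u = var_y; v = var_z;
          P = subst (fst S) (cst a + u) (cst b + u * v);
          Q = subst (snd S) (cst a + u) (cst b + u * v);
          u' = P - cst (\<delta> a)
      in (u', (Q - cst (\<delta> b) - v * u') / u))"

text \<open>\<open>y = a + U V\<close>, \<open>z = b + V\<close>; the exceptional curve is \<open>V = 0\<close>.\<close>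
definition blowup_UV :: "('k \<Rightarrow> 'k) \<Rightarrow> 'k \<times> 'k \<Rightarrow> 'k::field system \<Rightarrow> 'k system" where
  "blowup_UV \<delta> w S =
     (let a = fst w; b = snd w; U = var_y; V = var_z;
          P = subst (fst S) (cst a + U * V) (cst b + V);
          Q = subst (snd S) (cst a + U * V) (cst b + V);
          V' = Q - cst (\<delta> b)
      in ((P - cst (\<delta> a) - U * V') / V, V'))"

text \<open>The base points on the exceptional curve of the blow-up at \<open>w\<close>. The point \<open>(0, b)\<close>,
  \<open>b \<noteq> 0\<close>, of the first chart is the point \<open>(1/b, 0)\<close> of the second one; a base point visible in
  both charts is listed in the first chart only.\<close>
definition new_base_uv :: "('k \<Rightarrow> 'k) \<Rightarrow> 'k \<times> 'k \<Rightarrow> 'k::field system \<Rightarrow> 'k set" where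
  "new_base_uv \<delta> w S = {b. base_point (blowup_uv \<delta> w S) (0, b)}"

definition new_base_UV :: "('k \<Rightarrow> 'k) \<Rightarrow> 'k \<times> 'k \<Rightarrow> 'k::field system \<Rightarrow> 'k set" where
  "new_base_UV \<delta> w S =
     {a. base_point (blowup_UV \<delta> w S) (a, 0) \<and> \<not> (a \<noteq> 0 \<and> 1 / a \<in> new_base_uv \<delta> w S)}"

text \<open>\<open>resolved \<delta> S w\<close>: all cascades starting with the blow-up of \<open>S\<close> at \<open>w\<close> are finite, and at the
  end of each of them the system is regular on the last exceptional curve in one of the two final
  charts.\<close>
inductive resolved :: "('k \<Rightarrow> 'k) \<Rightarrow> 'k::field system \<Rightarrow> 'k \<times> 'k \<Rightarrow> bool" for \<delta> where
  final:
    "new_base_uv \<delta> w S = {} \<Longrightarrow> new_base_UV \<delta> w S = {} \<Longrightarrow>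
     (\<forall>b. regular_at (blowup_uv \<delta> w S) (0, b)) \<or> (\<forall>a. regular_at (blowup_UV \<delta> w S) (a, 0)) \<Longrightarrow>
     resolved \<delta> S w"
| continue:
    "new_base_uv \<delta> w S \<noteq> {} \<or> new_base_UV \<delta> w S \<noteq> {} \<Longrightarrow>
     (\<And>b. b \<in> new_base_uv \<delta> w S \<Longrightarrow> resolved \<delta> (blowup_uv \<delta> w S) (0, b)) \<Longrightarrow>
     (\<And>a. a \<in> new_base_UV \<delta> w S \<Longrightarrow> resolved \<delta> (blowup_UV \<delta> w S) (a, 0)) \<Longrightarrow>
     resolved \<delta> S w"

text \<open>Base points visible in several charts of the plane are again treated once, by means of
  \<open>[1:y:z] = [u\<^sub>0:1:v\<^sub>0] = [V\<^sub>0:U\<^sub>0:1]\<close>.\<close>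
definition regularised :: "('k \<Rightarrow> 'k) \<Rightarrow> 'k::field system \<Rightarrow> bool" where
  "regularised \<delta> S \<longleftrightarrow>
     (\<forall>w. base_point S w \<longrightarrow> resolved \<delta> S w) \<and>
     (\<forall>u v. base_point (chart_u0v0 S) (u, v) \<and>
            \<not> (u \<noteq> 0 \<and> base_point S (1 / u, v / u)) \<longrightarrow>
            resolved \<delta> (chart_u0v0 S) (u, v)) \<and>
     (\<forall>U V. base_point (chart_U0V0 S) (U, V) \<and>
            \<not> (V \<noteq> 0 \<and> base_point S (U / V, 1 / V)) \<and>
            \<not> (U \<noteq> 0 \<and> base_point (chart_u0v0 S) (V / U, 1 / U)) \<longrightarrow>
            resolved \<delta> (chart_U0V0 S) (U, V))"


section \<open>Functions meromorphic on a domain as elements of a differential field\<close>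

text \<open>
  A meromorphic function on a domain \<open>D\<close> is represented by its Laurent series at a point
  \<open>x\<^sub>0 \<in> D\<close>. As \<open>D\<close> is connected, \<open>mero_germs D x\<^sub>0\<close> is a copy of the differential
  field of meromorphic functions on \<open>D\<close> inside \<open>(complex fls, fls_deriv)\<close>. Base points are sought
  with coordinates in all of \<open>complex fls\<close> and for all \<open>x\<^sub>0\<close>: in this way base points that are
  branches of algebraic (multivalued) functions are also found, at all but a discrete set of \<open>x\<^sub>0\<close>.
\<close>

definition mero_germs :: "complex set \<Rightarrow> complex \<Rightarrow> complex fls set" where
  "mero_germs D x0 = {laurent_expansion f x0 | f. f meromorphic_on D}"

text \<open>The germ at \<open>x\<^sub>0\<close> of the independent variable.\<close>
definition germ_x :: "complex \<Rightarrow> complex fls" where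
  "germ_x x0 = fls_const x0 + fls_X"


section \<open>The second Painleve equation\<close>

definition PII_transcendent :: "complex set \<Rightarrow> complex \<Rightarrow> (complex \<Rightarrow> complex) \<Rightarrow> bool" where
  "PII_transcendent D \<alpha> q \<longleftrightarrow>
     q meromorphic_on D \<and>
     (\<forall>x\<in>D. q analytic_on {x} \<longrightarrow> deriv (deriv q) x = 2 * q x ^ 3 + x * q x + \<alpha>)"

definition hamiltonian_PII :: "complex \<Rightarrow> complex fls \<Rightarrow> complex fls system" where
  "hamiltonian_PII \<alpha> x =
     (var_z - var_y\<^sup>2 - cst (x / 2),
      2 * var_y * var_z + cst (fls_const (\<alpha> + 1 / 2)))"


section \<open>Systems whose coefficients are functions of an undetermined function\<close>

text \<open>Differential polynomials over the complex numbers in \<open>x\<close> and \<open>q\<close>; \<open>DP_jet k\<close> is the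
  \<open>k\<close>-th derivative of \<open>q\<close>.\<close>
datatype diff_poly =
    DP_const complex
  | DP_x
  | DP_jet nat
  | DP_add diff_poly diff_poly
  | DP_mult diff_poly diff_poly

primrec dp_eval :: "complex fls \<Rightarrow> complex fls \<Rightarrow> diff_poly \<Rightarrow> complex fls" where
  "dp_eval x q (DP_const c) = fls_const c"
| "dp_eval x q DP_x = x"
| "dp_eval x q (DP_jet k) = (fls_deriv ^^ k) q"
| "dp_eval x q (DP_add A B) = dp_eval x q A + dp_eval x q B"
| "dp_eval x q (DP_mult A B) = dp_eval x q A * dp_eval x q B"

text \<open>Polynomials in \<open>y, z\<close> whose coefficients are differential polynomials, as lists of lists of
  coefficients.\<close>
definition dp_poly :: "complex fls \<Rightarrow> complex fls \<Rightarrow> diff_poly list list \<Rightarrow> complex fls poly poly" where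
  "dp_poly x q css = Poly (map (\<lambda>cs. Poly (map (dp_eval x q) cs)) css)"

text \<open>A system depending on an undetermined function assigns a system to the germs of \<open>x\<close> and \<open>q\<close>.\<close>
type_synonym system_family = "complex fls \<Rightarrow> complex fls \<Rightarrow> complex fls system"

text \<open>\<open>(n\<^sub>1, d\<^sub>1, n\<^sub>2, d\<^sub>2)\<close> defines the family by \<open>y' = n\<^sub>1/d\<^sub>1\<close>, \<open>z' = n\<^sub>2/d\<^sub>2\<close> for all \<open>q\<close> for which
  neither \<open>d\<^sub>1\<close> nor \<open>d\<^sub>2\<close> is the zero polynomial. Coefficients that are rational in
  \<open>x, q, q', q'', \<dots>\<close> are brought to this form by clearing denominators.\<close>
type_synonym presentation =
  "diff_poly list list \<times> diff_poly list list \<times> diff_poly list list \<times> diff_poly list list"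

definition well_defined :: "presentation \<Rightarrow> complex fls \<Rightarrow> complex fls \<Rightarrow> bool" where
  "well_defined R x q = (case R of (n1, d1, n2, d2) \<Rightarrow> dp_poly x q d1 \<noteq> 0 \<and> dp_poly x q d2 \<noteq> 0)"

definition presents :: "presentation \<Rightarrow> system_family \<Rightarrow> bool" where
  "presents R S =
     (case R of (n1, d1, n2, d2) \<Rightarrow>
       \<forall>x q. well_defined R x q \<longrightarrow>
         S x q = (Fract (dp_poly x q n1) (dp_poly x q d1), Fract (dp_poly x q n2) (dp_poly x q d2)))"

definition well_defined_on :: "presentation \<Rightarrow> complex set \<Rightarrow> (complex \<Rightarrow> complex) \<Rightarrow> bool" where
  "well_defined_on R D q \<longleftrightarrow> (\<forall>x0\<in>D. well_defined R (germ_x x0) (laurent_expansion q x0))"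

definition regularised_on :: "complex set \<Rightarrow> system_family \<Rightarrow> (complex \<Rightarrow> complex) \<Rightarrow> bool" where
  "regularised_on D S q \<longleftrightarrow>
     (\<forall>x0\<in>D. regularised fls_deriv (S (germ_x x0) (laurent_expansion q x0)))"

definition solves_all :: "complex set \<Rightarrow> diff_poly set \<Rightarrow> (complex \<Rightarrow> complex) \<Rightarrow> bool" where
  "solves_all D C q \<longleftrightarrow>
     (\<forall>A\<in>C. \<forall>x0\<in>D. dp_eval (germ_x x0) (laurent_expansion q x0) A = 0)"

text \<open>\<open>C\<close> is a system of regularising conditions: for an a priori undetermined \<open>q\<close>, the system is
  regularised iff \<open>q\<close> satisfies the differential equations \<open>A = 0\<close>, \<open>A \<in> C\<close>. The last conjunct
  says that these are genuine equations, i.e. not satisfied by every \<open>q\<close>.\<close>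
definition regularising_conditions ::
    "complex set \<Rightarrow> presentation \<Rightarrow> system_family \<Rightarrow> diff_poly set \<Rightarrow> bool" where
  "regularising_conditions D R S C \<longleftrightarrow>
     finite C \<and>
     (\<forall>q. q meromorphic_on D \<and> well_defined_on R D q \<longrightarrow>
          (regularised_on D S q \<longleftrightarrow> solves_all D C q)) \<and>
     (\<exists>q. q meromorphic_on D \<and> well_defined_on R D q \<and> \<not> solves_all D C q)"

definition bureau_guillot_PII ::
    "complex set \<Rightarrow> complex \<Rightarrow> (complex \<Rightarrow> complex) \<Rightarrow> system_family \<Rightarrow> bool" where
  "bureau_guillot_PII D \<alpha> q S \<longleftrightarrow>
     (\<forall>x0\<in>D. birationally_equivalent fls_deriv (mero_germs D x0)
        (S (germ_x x0) (laurent_expansion q x0)) (hamiltonian_PII \<alpha> (germ_x x0))) \<and>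
     (\<forall>x0\<in>D. coeffs_in (mero_germs D x0) (fst (S (germ_x x0) (laurent_expansion q x0))) \<and>
              coeffs_in (mero_germs D x0) (snd (S (germ_x x0) (laurent_expansion q x0)))) \<and>
     (\<exists>R. presents R S \<and> well_defined_on R D q \<and>
        (\<exists>C. regularising_conditions D R S C \<and>
             (\<forall>r. PII_transcendent D \<alpha> r \<and> well_defined_on R D r \<longrightarrow> solves_all D C r)))"

definition modified_XIII :: "complex \<Rightarrow> complex \<Rightarrow> system_family" where
  "modified_XIII a1 a2 x q =
     (let c = (\<lambda>k. cst (fls_const k)); y = var_y; z = var_z; Q = cst q; Q' = cst (fls_deriv q)
      in (c (a1 / a2) * (2 * Q\<^sup>2 + 2 * Q' + cst x) - c (a2 / a1) * y\<^sup>2 + 3 * c a1 * y * z + 4 * y * Q,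
          z * (c (a2 / a1) * y - c a1 * z - 2 * Q)))"

end

theory Submission
  imports Defs "HOL-Computational_Algebra.Field_as_Ring"
begin

text \<open>
  All computations take place in the local ring of rational functions that have a value at a given
  point. Suppose that near \<open>(0, b)\<close> a system has the form \<open>y' = A\<close>,
  \<open>z' = (y B\<^sub>1 + (z - b) B\<^sub>2)/y\<close> with \<open>A\<close>, \<open>B\<^sub>1\<close>, \<open>B\<^sub>2\<close> in the local ring, with values \<open>a\<close>, \<open>b\<^sub>1\<close>, \<open>b\<^sub>2\<close>.
  Blowing up \<open>(0, b)\<close> gives a system of the same form in which \<open>b\<^sub>2\<close> is replaced by \<open>b\<^sub>2 - a\<close> and whose
  only base point on the exceptional curve is \<open>z = (\<delta> b - b\<^sub>1)/(b\<^sub>2 - a)\<close>. The cascade ends when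
  \<open>b\<^sub>2 = a\<close>, and the system is then regular on the last exceptional curve iff \<open>\<delta> b = b\<^sub>1\<close>.

  The modified system XIII has three base points on the line at infinity. The first one is always
  resolved, after two blow-ups; the second one is resolved, after four blow-ups, iff
  \<open>q''' = 6 q\<^sup>2 q' + q + x q'\<close>, the derivative of PII; and the third one is resolved under the same
  condition, its cascade passing through different charts when \<open>2 q\<^sup>2 + 2 q' + x = 0\<close>.
\<close>


subsection \<open>Unique factorisation over Laurent series\<close>

text \<open>Base points are defined through lowest terms, which are out of reach for systems known
  only as iterated pull-backs. They are replaced by a test in the local ring: \<open>h\<close> is
  0/0 at \<open>w\<close> iff neither \<open>h\<close> nor \<open>1 / h\<close> has a value there.
  The test needs gcds of polynomials over the coefficient field, whence the class instances for
  Laurent series.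

  The length of a cascade is the quotient \<open>b\<^sub>2 / a\<close> at its first centre, since
  every blow-up lowers \<open>b\<^sub>2\<close> by \<open>a\<close>. It is 2 at the first base point
  and 4 at the two others. At the last stage the denominator of the formula for the next centre
  vanishes, and its numerator \<open>\<delta> b - b\<^sub>1\<close> becomes a compatibility
  condition, like a resonance in the Painleve test. The centres already contain derivatives of
  \<open>q\<close>, so the condition at the second base point has order three. The system does not
  contain \<alpha>, so no condition on \<open>q\<close> can single out one value of it;
  differentiating PII eliminates it.\<close>

instantiation fls :: (field)
  "{unique_euclidean_ring, normalization_euclidean_semiring, normalization_semidom_multiplicative}"
begin

definition [simp]: "normalize_fls = (normalize_field :: 'a fls \<Rightarrow> _)"
definition [simp]: "unit_factor_fls = (unit_factor_field :: 'a fls \<Rightarrow> _)"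
definition [simp]: "modulo_fls = (mod_field :: 'a fls \<Rightarrow> _)"
definition [simp]: "euclidean_size_fls = (euclidean_size_field :: 'a fls \<Rightarrow> _)"
definition [simp]: "division_segment (x :: 'a fls) = 1"

instance
  by standard (simp_all add: dvd_field_iff field_split_simps split: if_splits)

end

instantiation fls :: (field) euclidean_ring_gcd
begin

definition gcd_fls :: "'a fls \<Rightarrow> 'a fls \<Rightarrow> 'a fls" where
  "gcd_fls = Euclidean_Algorithm.gcd"
definition lcm_fls :: "'a fls \<Rightarrow> 'a fls \<Rightarrow> 'a fls" where
  "lcm_fls = Euclidean_Algorithm.lcm"
definition Gcd_fls :: "'a fls set \<Rightarrow> 'a fls" where
  "Gcd_fls = Euclidean_Algorithm.Gcd"
definition Lcm_fls :: "'a fls set \<Rightarrow> 'a fls" where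
  "Lcm_fls = Euclidean_Algorithm.Lcm"

instance
  by standard (simp_all add: gcd_fls_def lcm_fls_def Gcd_fls_def Lcm_fls_def)

end

instance fls :: (field) field_gcd ..


subsection \<open>Constants and variables\<close>

lemma cst_0 [simp]: "cst 0 = 0"
  by (simp add: cst_def Zero_fract_def)

lemma cst_1 [simp]: "cst 1 = 1"
  by (simp add: cst_def One_fract_def one_pCons)

lemma cst_add: "cst (a + b) = cst a + cst b"
  by (simp add: cst_def)

lemma cst_mult: "cst (a * b) = cst a * cst b"
  by (simp add: cst_def)

lemma cst_minus: "cst (- a) = - cst a"
  by (simp add: cst_def)

lemma cst_diff: "cst (a - b) = cst a - cst b"
  using cst_add[of "a - b" b] by simp

lemma cst_eq_0_iff [simp]: "cst a = 0 \<longleftrightarrow> a = 0"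
  by (simp add: cst_def Zero_fract_def eq_fract)

lemma cst_divide: "cst (a / b) = cst a / cst b"
  by (metis cst_0 cst_eq_0_iff cst_mult div_by_0 nonzero_eq_divide_eq)

lemma cst_power: "cst (a ^ n) = cst a ^ n"
  by (induction n) (simp_all add: cst_mult)

lemma cst_of_nat: "cst (of_nat n) = of_nat n"
  by (induction n) (simp_all add: cst_add)

lemma cst_numeral [simp]: "cst (numeral n) = numeral n"
  using cst_of_nat[of "numeral n"] by simp

lemma numeral_ratfun_neq_0 [simp]: "(numeral n :: 'k::field_char_0 ratfun) \<noteq> 0"
  using cst_eq_0_iff[of "numeral n :: 'k"] by simp

lemmas cst_simps = cst_add cst_mult cst_minus cst_diff cst_divide cst_power

lemma var_y_neq_0 [simp]: "var_y \<noteq> 0"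
  by (simp add: var_y_def Zero_fract_def eq_fract)

lemma var_z_neq_0 [simp]: "var_z \<noteq> 0"
  by (simp add: var_z_def Zero_fract_def eq_fract)


subsection \<open>Values of rational functions\<close>

lemma eval_at_simps [simp]:
  "eval_at 0 w = 0" "eval_at 1 w = 1"
  "eval_at (p + q) w = eval_at p w + eval_at q w"
  "eval_at (p - q) w = eval_at p w - eval_at q w"
  "eval_at (- p) w = - eval_at p w"
  "eval_at (p * q) w = eval_at p w * eval_at q w"
  "eval_at [:[:k:]:] w = k"
  "eval_at [:[:0, 1:]:] w = fst w"
  "eval_at [:0, 1:] w = snd w"
  by (simp_all add: eval_at_def)

lemma eval_at_pCons: "eval_at (pCons c p) w = poly c (fst w) + snd w * eval_at p w"
  by (simp add: eval_at_def)

definition has_val :: "'k::field ratfun \<Rightarrow> 'k \<times> 'k \<Rightarrow> 'k \<Rightarrow> bool" where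
  "has_val h w c \<longleftrightarrow> (\<exists>n d. eval_at d w \<noteq> 0 \<and> h = Fract n d \<and> c = eval_at n w / eval_at d w)"

lemma eval_at_nonzero: "eval_at d w \<noteq> 0 \<Longrightarrow> d \<noteq> 0"
  by auto

lemma has_val_unique:
  assumes "has_val h w c" "has_val h w c'"
  shows "c = c'"
proof -
  obtain n d where 1: "eval_at d w \<noteq> 0" "h = Fract n d" "c = eval_at n w / eval_at d w"
    using assms(1) by (auto simp: has_val_def)
  obtain n' d' where 2: "eval_at d' w \<noteq> 0" "h = Fract n' d'" "c' = eval_at n' w / eval_at d' w"
    using assms(2) by (auto simp: has_val_def)
  have "n * d' = n' * d"
    using 1 2 by (metis eq_fract(1) eval_at_nonzero)
  hence "eval_at n w * eval_at d' w = eval_at n' w * eval_at d w"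
    by (metis eval_at_simps(6))
  thus ?thesis
    using 1 2 by (simp add: frac_eq_eq)
qed

text \<open>Applied backwards: the introduction rules compute some value of an expression, and
  arithmetic then identifies it with the expected one.\<close>

lemma has_val_cong: "has_val h w c \<Longrightarrow> c = c' \<Longrightarrow> has_val h w c'"
  by simp

lemma has_val_cst: "has_val (cst k) w k"
  unfolding has_val_def cst_def by (intro exI[of _ "[:[:k:]:]"] exI[of _ 1]) auto

lemma has_val_var_y: "has_val var_y w (fst w)"
  unfolding has_val_def var_y_def by (intro exI[of _ "[:[:0, 1:]:]"] exI[of _ 1]) auto

lemma has_val_var_z: "has_val var_z w (snd w)"
  unfolding has_val_def var_z_def by (intro exI[of _ "[:0, 1:]"] exI[of _ 1]) auto

lemma has_val_add:
  assumes "has_val h w c" "has_val h' w c'"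
  shows "has_val (h + h') w (c + c')"
proof -
  obtain n d where 1: "eval_at d w \<noteq> 0" "h = Fract n d" "c = eval_at n w / eval_at d w"
    using assms(1) by (auto simp: has_val_def)
  obtain n' d' where 2: "eval_at d' w \<noteq> 0" "h' = Fract n' d'" "c' = eval_at n' w / eval_at d' w"
    using assms(2) by (auto simp: has_val_def)
  have "d \<noteq> 0" "d' \<noteq> 0"
    using 1 2 eval_at_nonzero by auto
  thus ?thesis
    unfolding has_val_def using 1 2
    by (intro exI[of _ "n * d' + n' * d"] exI[of _ "d * d'"]) (auto simp: field_simps)
qed

lemma has_val_mult:
  assumes "has_val h w c" "has_val h' w c'"
  shows "has_val (h * h') w (c * c')"
proof -
  obtain n d where 1: "eval_at d w \<noteq> 0" "h = Fract n d" "c = eval_at n w / eval_at d w"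
    using assms(1) by (auto simp: has_val_def)
  obtain n' d' where 2: "eval_at d' w \<noteq> 0" "h' = Fract n' d'" "c' = eval_at n' w / eval_at d' w"
    using assms(2) by (auto simp: has_val_def)
  show ?thesis
    unfolding has_val_def using 1 2
    by (rule_tac exI[of _ "n * n'"], rule_tac exI[of _ "d * d'"]) simp
qed

lemma has_val_minus:
  assumes "has_val h w c"
  shows "has_val (- h) w (- c)"
  using has_val_mult[OF has_val_cst[of "-1"] assms] by (simp add: cst_minus)

lemma has_val_diff:
  assumes "has_val h w c" "has_val h' w c'"
  shows "has_val (h - h') w (c - c')"
  using has_val_add[OF assms(1) has_val_minus[OF assms(2)]] by simp

lemma has_val_inverse:
  assumes "has_val h w c" "c \<noteq> 0"
  shows "has_val (inverse h) w (inverse c)"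
proof -
  obtain n d where "eval_at d w \<noteq> 0" "h = Fract n d" "c = eval_at n w / eval_at d w"
    using assms(1) by (auto simp: has_val_def)
  thus ?thesis
    unfolding has_val_def using assms(2)
    by (intro exI[of _ d] exI[of _ n]) auto
qed

lemma has_val_divide:
  assumes "has_val h w c" "has_val h' w c'" "c' \<noteq> 0"
  shows "has_val (h / h') w (c / c')"
  using has_val_mult[OF assms(1) has_val_inverse[OF assms(2,3)]] by (simp add: divide_inverse)

lemma has_val_power:
  assumes "has_val h w c"
  shows "has_val (h ^ n) w (c ^ n)"
proof (induction n)
  case 0
  show ?case using has_val_cst[of 1 w] by simp
next
  case (Suc n)
  thus ?case using has_val_mult[OF assms Suc] by simp
qed

lemma has_val_numeral: "has_val (numeral k) w (numeral k)"
  using has_val_cst[of "numeral k" w] by simp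

lemma has_val_0: "has_val 0 w 0" and has_val_1: "has_val 1 w 1"
  using has_val_cst[of 0 w] has_val_cst[of 1 w] by simp_all

lemmas has_val_intros = has_val_cst has_val_var_y has_val_var_z has_val_add has_val_mult
  has_val_minus has_val_diff has_val_divide has_val_power has_val_numeral has_val_0 has_val_1

lemma regular_at_iff:
  "regular_at S w \<longleftrightarrow> (\<exists>c. has_val (fst S) w c) \<and> (\<exists>c. has_val (snd S) w c)"
  unfolding regular_at_def has_val_def by blast

lemma not_has_val_if_pole:
  assumes "h \<noteq> 0" "has_val (1 / h) w 0"
  shows "\<not> has_val h w c"
proof
  assume "has_val h w c"
  from has_val_mult[OF this assms(2)] have "has_val 1 w 0"
    using assms(1) by simp
  thus False
    using has_val_unique[OF _ has_val_1] by fastforce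
qed

text \<open>Lowest terms exist and are unique up to units because the polynomial ring is factorial.\<close>

lemma indeterminate_at_iff:
  fixes h :: "'k::field_gcd ratfun"
  shows "indeterminate_at h w \<longleftrightarrow> (\<nexists>c. has_val h w c) \<and> (\<nexists>c. has_val (1 / h) w c)"
proof
  assume "indeterminate_at h w"
  then obtain n d where nd: "d \<noteq> 0" "coprime n d" "h = Fract n d" "eval_at n w = 0" "eval_at d w = 0"
    by (auto simp: indeterminate_at_def)
  have "\<not> has_val h w c" for c
  proof
    assume "has_val h w c"
    then obtain n' d' where 1: "eval_at d' w \<noteq> 0" "h = Fract n' d'"
      by (auto simp: has_val_def)
    have "n * d' = n' * d"
      using 1 nd by (metis eq_fract(1) eval_at_nonzero)
    \<comment> \<open>Coprimality makes \<open>d\<close> divide every other denominator of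
      \<open>h\<close>, so all of them vanish at \<open>w\<close>.\<close>
    hence "d dvd d'"
      using nd(2) by (metis coprime_commute coprime_dvd_mult_right_iff dvd_triv_right)
    thus False
      using 1 nd by (auto elim!: dvdE)
  qed
  moreover have "\<not> has_val (1 / h) w c" for c
  proof
    assume "has_val (1 / h) w c"
    then obtain n' d' where 1: "eval_at d' w \<noteq> 0" "1 / h = Fract n' d'"
      by (auto simp: has_val_def)
    show False
    proof (cases "n = 0")
      case True
      with nd(3) have "h = 0"
        by (simp add: Zero_fract_def eq_fract)
      thus False
        using calculation[of 0] has_val_0[of w] by simp
    next
      case False
      have "Fract d n = Fract n' d'"
        using 1 nd(3) by (simp add: divide_inverse)
      hence "d * d' = n' * n"
        using False 1(1) eq_fract(1) eval_at_nonzero by blast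
      hence "n dvd d'"
        using nd(2) by (metis coprime_dvd_mult_right_iff dvd_triv_right)
      thus False
        using 1 nd by (auto elim!: dvdE)
    qed
  qed
  ultimately show "(\<nexists>c. has_val h w c) \<and> (\<nexists>c. has_val (1 / h) w c)"
    by blast
next
  assume *: "(\<nexists>c. has_val h w c) \<and> (\<nexists>c. has_val (1 / h) w c)"
  obtain n d where nd: "h = Fract n d" "d \<noteq> 0"
    by (cases h)
  define g where "g = gcd n d"
  have "g \<noteq> 0"
    using nd by (simp add: g_def)
  obtain n' d' where n': "n = g * n'" and d': "d = g * d'" and cop: "coprime n' d'"
    using gcd_coprime_exists[of n d] \<open>g \<noteq> 0\<close> unfolding g_def by (metis mult.commute)
  have h: "h = Fract n' d'"
    using nd n' d' \<open>g \<noteq> 0\<close> by (metis mult_fract_cancel)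
  have "eval_at d' w = 0"
    using * h by (auto simp: has_val_def)
  moreover have "eval_at n' w = 0"
    using * h by (auto simp: has_val_def divide_inverse)
  ultimately show "indeterminate_at h w"
    unfolding indeterminate_at_def using h cop nd(2) d' by auto
qed


subsection \<open>Substitution\<close>

abbreviation inner_subst :: "'k::field poly \<Rightarrow> 'k ratfun \<Rightarrow> 'k ratfun" where
  "inner_subst c f \<equiv> poly (map_poly cst c) f"

lemma inner_subst_pCons: "inner_subst (pCons k c) f = cst k + f * inner_subst c f"
  by (simp add: map_poly_pCons)

lemma poly_subst_0 [simp]: "poly_subst 0 f g = 0"
  by (simp add: poly_subst_def)

lemma poly_subst_pCons: "poly_subst (pCons c p) f g = inner_subst c f + g * poly_subst p f g"
  by (simp add: poly_subst_def map_poly_pCons)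

lemma inner_subst_add: "inner_subst (c + d) f = inner_subst c f + inner_subst d f"
proof (induction c d rule: poly_induct2)
  case (pCons a p b q)
  thus ?case by (simp add: inner_subst_pCons cst_add algebra_simps)
qed simp

lemma inner_subst_smult: "inner_subst (smult k c) f = cst k * inner_subst c f"
  by (induction c) (simp_all add: inner_subst_pCons cst_mult algebra_simps)

lemma inner_subst_mult: "inner_subst (c * d) f = inner_subst c f * inner_subst d f"
  by (induction c) (simp_all add: inner_subst_pCons inner_subst_add inner_subst_smult algebra_simps)

lemma poly_subst_add: "poly_subst (p + q) f g = poly_subst p f g + poly_subst q f g"
proof (induction p q rule: poly_induct2)
  case (pCons a p b q)
  thus ?case by (simp add: poly_subst_pCons inner_subst_add algebra_simps)
qed simp

lemma poly_subst_smult: "poly_subst (smult c p) f g = inner_subst c f * poly_subst p f g"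
  by (induction p) (simp_all add: poly_subst_pCons inner_subst_mult algebra_simps)

lemma poly_subst_mult: "poly_subst (p * q) f g = poly_subst p f g * poly_subst q f g"
  by (induction p) (simp_all add: poly_subst_pCons poly_subst_add poly_subst_smult algebra_simps)

lemma poly_subst_base:
  "poly_subst [:[:k:]:] f g = cst k"
  "poly_subst [:[:0, 1:]:] f g = f"
  "poly_subst [:0, 1:] f g = g"
  "poly_subst 1 f g = 1"
  by (simp_all add: poly_subst_pCons inner_subst_pCons one_pCons)

lemma is_subst_unique:
  assumes "is_subst h f g r" "is_subst h f g r'"
  shows "r = r'"
proof -
  obtain n d where 1: "d \<noteq> 0" "h = Fract n d" "poly_subst d f g \<noteq> 0"
      "r = poly_subst n f g / poly_subst d f g"
    using assms(1) by (auto simp: is_subst_def)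
  obtain n' d' where 2: "d' \<noteq> 0" "h = Fract n' d'" "poly_subst d' f g \<noteq> 0"
      "r' = poly_subst n' f g / poly_subst d' f g"
    using assms(2) by (auto simp: is_subst_def)
  have "n * d' = n' * d"
    using 1 2 by (metis eq_fract(1))
  hence "poly_subst n f g * poly_subst d' f g = poly_subst n' f g * poly_subst d f g"
    by (metis poly_subst_mult)
  thus ?thesis
    using 1 2 by (simp add: frac_eq_eq)
qed

lemma subst_eqI: "is_subst h f g r \<Longrightarrow> subst h f g = r"
  unfolding subst_def by (blast intro: is_subst_unique)

lemma is_subst_cst: "is_subst (cst k) f g (cst k)"
  unfolding is_subst_def cst_def[of k]
  by (rule exI[of _ "[:[:k:]:]"], rule exI[of _ 1]) (simp add: poly_subst_base cst_def)

lemma is_subst_var_y: "is_subst var_y f g f"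
  unfolding is_subst_def var_y_def
  by (rule exI[of _ "[:[:0, 1:]:]"], rule exI[of _ 1]) (simp add: poly_subst_base)

lemma is_subst_var_z: "is_subst var_z f g g"
  unfolding is_subst_def var_z_def
  by (rule exI[of _ "[:0, 1:]"], rule exI[of _ 1]) (simp add: poly_subst_base)

lemma is_subst_add:
  assumes "is_subst h f g r" "is_subst h' f g r'"
  shows "is_subst (h + h') f g (r + r')"
proof -
  obtain n d where 1: "d \<noteq> 0" "h = Fract n d" "poly_subst d f g \<noteq> 0"
      "r = poly_subst n f g / poly_subst d f g"
    using assms(1) by (auto simp: is_subst_def)
  obtain n' d' where 2: "d' \<noteq> 0" "h' = Fract n' d'" "poly_subst d' f g \<noteq> 0"
      "r' = poly_subst n' f g / poly_subst d' f g"
    using assms(2) by (auto simp: is_subst_def)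
  show ?thesis
    unfolding is_subst_def
    by (rule exI[of _ "n * d' + n' * d"], rule exI[of _ "d * d'"])
      (use 1 2 in \<open>auto simp: poly_subst_add poly_subst_mult add_frac_eq mult_ac\<close>)
qed

lemma is_subst_mult:
  assumes "is_subst h f g r" "is_subst h' f g r'"
  shows "is_subst (h * h') f g (r * r')"
proof -
  obtain n d where 1: "d \<noteq> 0" "h = Fract n d" "poly_subst d f g \<noteq> 0"
      "r = poly_subst n f g / poly_subst d f g"
    using assms(1) by (auto simp: is_subst_def)
  obtain n' d' where 2: "d' \<noteq> 0" "h' = Fract n' d'" "poly_subst d' f g \<noteq> 0"
      "r' = poly_subst n' f g / poly_subst d' f g"
    using assms(2) by (auto simp: is_subst_def)
  show ?thesis
    unfolding is_subst_def
    by (rule exI[of _ "n * n'"], rule exI[of _ "d * d'"])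
      (use 1 2 in \<open>auto simp: poly_subst_mult\<close>)
qed

lemma is_subst_inverse:
  assumes "is_subst h f g r" "r \<noteq> 0"
  shows "is_subst (inverse h) f g (inverse r)"
proof -
  obtain n d where 1: "d \<noteq> 0" "h = Fract n d" "poly_subst d f g \<noteq> 0"
      "r = poly_subst n f g / poly_subst d f g"
    using assms(1) by (auto simp: is_subst_def)
  hence "poly_subst n f g \<noteq> 0"
    using assms(2) by auto
  moreover from this have "n \<noteq> 0"
    by auto
  ultimately show ?thesis
    unfolding is_subst_def
    by (rule_tac exI[of _ d], rule_tac exI[of _ n]) (use 1 in auto)
qed

lemma is_subst_divide:
  assumes "is_subst h f g r" "is_subst h' f g r'" "r' \<noteq> 0"
  shows "is_subst (h / h') f g (r / r')"
  using is_subst_mult[OF assms(1) is_subst_inverse[OF assms(2,3)]] by (simp add: divide_inverse)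

lemma is_subst_minus:
  assumes "is_subst h f g r"
  shows "is_subst (- h) f g (- r)"
  using is_subst_mult[OF is_subst_cst[of "-1"] assms] by (simp add: cst_minus)

lemma is_subst_diff:
  assumes "is_subst h f g r" "is_subst h' f g r'"
  shows "is_subst (h - h') f g (r - r')"
  using is_subst_add[OF assms(1) is_subst_minus[OF assms(2)]] by simp

lemma is_subst_numeral: "is_subst (numeral k) f g (numeral k)"
  using is_subst_cst[of "numeral k"] by simp

lemma is_subst_power:
  assumes "is_subst h f g r"
  shows "is_subst (h ^ n) f g (r ^ n)"
proof (induction n)
  case 0
  show ?case using is_subst_cst[of 1] by simp
next
  case (Suc n)
  thus ?case using is_subst_mult[OF assms Suc] by simp
qed

lemmas is_subst_intros = is_subst_cst is_subst_var_y is_subst_var_z is_subst_add is_subst_mult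
  is_subst_divide is_subst_minus is_subst_diff is_subst_numeral is_subst_power

text \<open>Algebraic independence of \<open>f\<close> and \<open>g\<close>: the substitution is
  then an injective field homomorphism defined on all rational functions.\<close>

definition dominant :: "'k::field ratfun \<Rightarrow> 'k ratfun \<Rightarrow> bool" where
  "dominant f g \<longleftrightarrow> (\<forall>p. p \<noteq> 0 \<longrightarrow> poly_subst p f g \<noteq> 0)"

lemma is_subst_subst:
  assumes "dominant f g"
  shows "is_subst h f g (subst h f g)"
proof -
  obtain n d where "h = Fract n d" "d \<noteq> 0"
    by (cases h)
  hence "is_subst h f g (poly_subst n f g / poly_subst d f g)"
    using assms unfolding is_subst_def dominant_def by blast
  thus ?thesis
    using subst_eqI by metis
qed

lemma subst_neq_0:
  assumes "dominant f g" "h \<noteq> 0"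
  shows "subst h f g \<noteq> 0"
proof -
  obtain n d where nd: "h = Fract n d" "d \<noteq> 0"
    by (cases h)
  hence "n \<noteq> 0"
    using assms(2) by (auto simp: Zero_fract_def eq_fract)
  moreover have "subst h f g = poly_subst n f g / poly_subst d f g"
    using nd assms(1) by (intro subst_eqI) (auto simp: is_subst_def dominant_def)
  ultimately show ?thesis
    using assms(1) nd by (simp add: dominant_def)
qed

lemma subst_base:
  "subst (cst k) f g = cst k" "subst var_y f g = f" "subst var_z f g = g"
  "subst 0 f g = 0" "subst 1 f g = 1" "subst (numeral m) f g = numeral m"
  using is_subst_cst[of 0 f g] is_subst_cst[of 1 f g]
  by (auto intro!: subst_eqI is_subst_intros)

context
  fixes f g :: "'k::field ratfun"
  assumes dom: "dominant f g"
begin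

lemma subst_add: "subst (h + h') f g = subst h f g + subst h' f g"
  by (intro subst_eqI is_subst_add is_subst_subst dom)

lemma subst_mult: "subst (h * h') f g = subst h f g * subst h' f g"
  by (intro subst_eqI is_subst_mult is_subst_subst dom)

lemma subst_minus: "subst (- h) f g = - subst h f g"
  by (intro subst_eqI is_subst_minus is_subst_subst dom)

lemma subst_diff: "subst (h - h') f g = subst h f g - subst h' f g"
  by (intro subst_eqI is_subst_diff is_subst_subst dom)

lemma subst_power: "subst (h ^ n) f g = subst h f g ^ n"
  by (intro subst_eqI is_subst_power is_subst_subst dom)

text \<open>For \<open>h' = 0\<close> both sides are 0 by the convention for division by
  zero.\<close>

lemma subst_divide: "subst (h / h') f g = subst h f g / subst h' f g"
proof (cases "h' = 0")
  case False
  thus ?thesis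
    by (intro subst_eqI is_subst_divide is_subst_subst subst_neq_0 dom)
qed (simp add: subst_base)

lemmas subst_simps = subst_base subst_add subst_mult subst_minus subst_diff subst_power subst_divide

end

section \<open>Dominance of the coordinate changes\<close>

lemma exists_nonzero_point:
  fixes p :: "'k::field_char_0 poly poly"
  assumes "p \<noteq> 0"
  shows "\<exists>w. eval_at p w \<noteq> 0"
proof -
  have inf: "infinite (range (\<lambda>n. of_nat n :: 'k))"
    by (intro range_inj_infinite inj_of_nat)
  have "infinite ((\<lambda>k. [:k:] :: 'k poly) ` range of_nat)"
    using inf by (subst finite_image_iff) (auto simp: inj_on_def)
  then obtain b where b: "poly p [:b:] \<noteq> 0"
    using poly_roots_finite[OF assms]
    by (metis (mono_tags, lifting) finite_subset imageE mem_Collect_eq subsetI)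
  from inf obtain a where "poly (poly p [:b:]) a \<noteq> 0"
    using poly_roots_finite[OF b]
    by (metis (mono_tags, lifting) finite_subset mem_Collect_eq subsetI)
  thus ?thesis
    unfolding eval_at_def by (intro exI[of _ "(a, b)"]) auto
qed

lemma has_val_inner_subst:
  assumes "has_val f w a"
  shows "has_val (inner_subst c f) w (poly c a)"
proof (induction c)
  case 0
  show ?case by (simp add: has_val_0)
next
  case (pCons k c)
  thus ?case
    unfolding inner_subst_pCons by (auto intro!: has_val_intros assms)
qed

lemma has_val_poly_subst:
  assumes "has_val f w a" "has_val g w b"
  shows "has_val (poly_subst p f g) w (eval_at p (a, b))"
proof (induction p)
  case 0
  show ?case by (simp add: has_val_0)
next
  case (pCons c p)
  thus ?case
    unfolding poly_subst_pCons eval_at_pCons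
    by (auto intro!: has_val_intros assms has_val_inner_subst)
qed

text \<open>A polynomial relation \<open>p\<close> between \<open>f\<close> and \<open>g\<close>
  vanishes at every pair of values they attain, hence everywhere off the curve \<open>e = 0\<close>.
  Then \<open>e * p\<close> vanishes at all points, which is impossible for a nonzero polynomial
  over an infinite field.\<close>

lemma dominantI:
  fixes f g :: "'k::field_char_0 ratfun"
  assumes "e \<noteq> 0"
  assumes "\<And>a b. eval_at e (a, b) \<noteq> 0 \<Longrightarrow> \<exists>w. has_val f w a \<and> has_val g w b"
  shows "dominant f g"
  unfolding dominant_def
proof (intro allI impI notI)
  fix p :: "'k poly poly"
  assume "p \<noteq> 0" and zero: "poly_subst p f g = 0"
  then obtain a b where ab: "eval_at (e * p) (a, b) \<noteq> 0"
    using exists_nonzero_point[of "e * p"] assms(1) by auto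
  then obtain w where "has_val f w a" "has_val g w b"
    using assms(2)[of a b] by auto
  from has_val_poly_subst[OF this, of p] have "eval_at p (a, b) = 0"
    unfolding zero using has_val_unique has_val_0 by blast
  with ab show False
    by simp
qed

text \<open>Here and in the next three lemmas the witness is the inverse of the coordinate change,
  defined off the curve \<open>e = 0\<close>.\<close>

lemma dominant_u0v0: "dominant (1 / var_y) (var_z / var_y :: 'k::field_char_0 ratfun)"
proof (rule dominantI)
  fix a b :: 'k
  assume "eval_at [:[:0, 1:]:] (a, b) \<noteq> 0"
  hence "a \<noteq> 0"
    by simp
  have "has_val (1 / var_y) (1 / a, b / a) a"
    by (rule has_val_cong, (rule has_val_intros)+) (use \<open>a \<noteq> 0\<close> in auto)
  moreover have "has_val (var_z / var_y) (1 / a, b / a) b"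
    by (rule has_val_cong, (rule has_val_intros)+) (use \<open>a \<noteq> 0\<close> in auto)
  ultimately show "\<exists>w. has_val (1 / var_y) w a \<and> has_val (var_z / var_y) w b"
    by blast
qed simp

lemma dominant_U0V0: "dominant (var_y / var_z) (1 / var_z :: 'k::field_char_0 ratfun)"
proof (rule dominantI)
  fix a b :: 'k
  assume "eval_at [:0, 1:] (a, b) \<noteq> 0"
  hence "b \<noteq> 0"
    by simp
  have "has_val (1 / var_z) (a / b, 1 / b) b"
    by (rule has_val_cong, (rule has_val_intros)+) (use \<open>b \<noteq> 0\<close> in auto)
  moreover have "has_val (var_y / var_z) (a / b, 1 / b) a"
    by (rule has_val_cong, (rule has_val_intros)+) (use \<open>b \<noteq> 0\<close> in auto)
  ultimately show "\<exists>w. has_val (var_y / var_z) w a \<and> has_val (1 / var_z) w b"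
    by blast
qed simp

lemma dominant_blowup_uv:
  "dominant (cst a + var_y) (cst b + var_y * var_z :: 'k::field_char_0 ratfun)"
proof (rule dominantI)
  fix y z :: 'k
  assume "eval_at [:[:- a, 1:]:] (y, z) \<noteq> 0"
  hence "y - a \<noteq> 0"
    by (simp add: eval_at_def)
  let ?w = "(y - a, (z - b) / (y - a))"
  have "has_val (cst a + var_y) ?w y"
    by (rule has_val_cong, (rule has_val_intros)+) auto
  moreover have "has_val (cst b + var_y * var_z) ?w z"
    by (rule has_val_cong, (rule has_val_intros)+) (use \<open>y - a \<noteq> 0\<close> in auto)
  ultimately show "\<exists>w. has_val (cst a + var_y) w y \<and> has_val (cst b + var_y * var_z) w z"
    by blast
qed simp

lemma dominant_blowup_UV:
  "dominant (cst a + var_y * var_z) (cst b + var_z :: 'k::field_char_0 ratfun)"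
proof (rule dominantI)
  fix y z :: 'k
  assume "eval_at [:[:- b:], 1:] (y, z) \<noteq> 0"
  hence "z - b \<noteq> 0"
    by (simp add: eval_at_def)
  let ?w = "((y - a) / (z - b), z - b)"
  have "has_val (cst b + var_z) ?w z"
    by (rule has_val_cong, (rule has_val_intros)+) auto
  moreover have "has_val (cst a + var_y * var_z) ?w y"
    by (rule has_val_cong, (rule has_val_intros)+) (use \<open>z - b \<noteq> 0\<close> in auto)
  ultimately show "\<exists>w. has_val (cst a + var_y * var_z) w y \<and> has_val (cst b + var_z) w z"
    by blast
qed simp


subsection \<open>Expansion along an exceptional curve\<close>

definition regular_on :: "('k \<times> 'k) set \<Rightarrow> 'k::field ratfun \<Rightarrow> bool" where
  "regular_on E h \<longleftrightarrow> (\<forall>w\<in>E. \<exists>c. has_val h w c)"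

lemma regular_on_cst: "regular_on E (cst c)"
  unfolding regular_on_def using has_val_cst by blast

lemma regular_on_add: "regular_on E h \<Longrightarrow> regular_on E h' \<Longrightarrow> regular_on E (h + h')"
  unfolding regular_on_def using has_val_add by blast

lemma regular_on_mult: "regular_on E h \<Longrightarrow> regular_on E h' \<Longrightarrow> regular_on E (h * h')"
  unfolding regular_on_def using has_val_mult by blast

lemma regular_on_diff: "regular_on E h \<Longrightarrow> regular_on E h' \<Longrightarrow> regular_on E (h - h')"
  unfolding regular_on_def using has_val_diff by blast

lemma regular_on_minus: "regular_on E h \<Longrightarrow> regular_on E (- h)"
  unfolding regular_on_def using has_val_minus by blast

lemma regular_on_var: "regular_on E var_y" "regular_on E var_z"
  unfolding regular_on_def using has_val_var_y has_val_var_z by blast+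

lemmas regular_on_intros = regular_on_cst regular_on_add regular_on_mult regular_on_diff
  regular_on_minus regular_on_var

context
  fixes E :: "('k::field \<times> 'k) set" and t f g f1 g1 :: "'k ratfun" and a b :: 'k
  assumes t: "\<And>w. w \<in> E \<Longrightarrow> has_val t w 0"
    and f: "f = cst a + t * f1" "regular_on E f1"
    and g: "g = cst b + t * g1" "regular_on E g1"
begin

private lemma regular_on_t: "regular_on E t"
  using t by (auto simp: regular_on_def)

lemma inner_subst_expansion:
  "\<exists>k. inner_subst c f = cst (poly c a) + t * k \<and> regular_on E k"
proof (induction c)
  case 0
  show ?case by (auto intro!: exI[of _ 0] regular_on_cst[of _ 0, simplified])
next
  case (pCons l c)
  then obtain k where k: "inner_subst c f = cst (poly c a) + t * k" "regular_on E k"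
    by blast
  have "inner_subst (pCons l c) f =
      cst (poly (pCons l c) a) + t * (cst a * k + f1 * (cst (poly c a) + t * k))"
    by (simp only: inner_subst_pCons k poly_pCons) (simp add: f cst_add cst_mult algebra_simps)
  moreover have "regular_on E (cst a * k + f1 * (cst (poly c a) + t * k))"
    by (intro regular_on_intros k f regular_on_t)
  ultimately show ?case
    by blast
qed

lemma poly_subst_expansion:
  "\<exists>k. poly_subst p f g = cst (eval_at p (a, b)) + t * k \<and> regular_on E k"
proof (induction p)
  case 0
  show ?case by (auto intro!: exI[of _ 0] regular_on_cst[of _ 0, simplified])
next
  case (pCons c p)
  then obtain k where k: "poly_subst p f g = cst (eval_at p (a, b)) + t * k" "regular_on E k"
    by blast
  obtain l where l: "inner_subst c f = cst (poly c a) + t * l" "regular_on E l"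
    using inner_subst_expansion by blast
  let ?k = "l + cst b * k + g1 * (cst (eval_at p (a, b)) + t * k)"
  have "poly_subst (pCons c p) f g = cst (eval_at (pCons c p) (a, b)) + t * ?k"
    by (simp only: poly_subst_pCons k l eval_at_pCons) (simp add: g cst_add cst_mult algebra_simps)
  moreover have "regular_on E ?k"
    by (intro regular_on_intros k l g regular_on_t)
  ultimately show ?case
    by blast
qed

text \<open>A Taylor expansion of first order: \<open>t\<close> is an equation of the curve
  \<open>E\<close>, on which \<open>(f, g)\<close> is constantly \<open>(a, b)\<close>. Of the
  cofactor \<open>k\<close> only its regularity on \<open>E\<close> is kept, which is enough to
  decide where poles and base points lie.\<close>

lemma subst_expansion:
  assumes h: "has_val h (a, b) c" and dom: "dominant f g"
  shows "\<exists>k. subst h f g = cst c + t * k \<and> regular_on E k"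
proof -
  obtain n d where nd: "eval_at d (a, b) \<noteq> 0" "h = Fract n d"
      "c = eval_at n (a, b) / eval_at d (a, b)"
    using h by (auto simp: has_val_def)
  let ?n = "eval_at n (a, b)" and ?d = "eval_at d (a, b)"
  obtain k where k: "poly_subst n f g = cst ?n + t * k" "regular_on E k"
    using poly_subst_expansion by blast
  obtain l where l: "poly_subst d f g = cst ?d + t * l" "regular_on E l"
    using poly_subst_expansion by blast
  have "d \<noteq> 0"
    using nd(1) by auto
  with dom have d0: "d \<noteq> 0" "poly_subst d f g \<noteq> 0"
    by (auto simp: dominant_def)
  hence "subst h f g = poly_subst n f g / poly_subst d f g"
    using nd by (intro subst_eqI) (auto simp: is_subst_def)
  also have "\<dots> = cst c + t * ((k - cst c * l) / poly_subst d f g)"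
  proof -
    have "cst ?n = cst c * cst ?d"
      using nd by (simp flip: cst_mult)
    hence "poly_subst n f g = cst c * poly_subst d f g + t * (k - cst c * l)"
      unfolding k(1) l(1) by (simp add: algebra_simps)
    thus ?thesis
      using d0(2) by (simp add: field_simps)
  qed
  finally have "subst h f g = cst c + t * ((k - cst c * l) / poly_subst d f g)" .
  moreover have "regular_on E ((k - cst c * l) / poly_subst d f g)"
    unfolding regular_on_def
  proof
    fix w assume w: "w \<in> E"
    obtain e1 where e1: "has_val (k - cst c * l) w e1"
      using regular_on_diff[OF k(2) regular_on_mult[OF regular_on_cst l(2)]] w
      unfolding regular_on_def by blast
    obtain e2 where e2: "has_val l w e2"
      using l(2) w unfolding regular_on_def by blast
    \<comment> \<open>The denominator is constant along \<open>E\<close>, with the same nonzero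
      value as at the centre.\<close>
    have "has_val (poly_subst d f g) w (?d + 0 * e2)"
      unfolding l(1) by (intro has_val_intros t w e2)
    hence "has_val (poly_subst d f g) w ?d"
      by simp
    from has_val_divide[OF e1 this nd(1)]
    show "\<exists>c'. has_val ((k - cst c * l) / poly_subst d f g) w c'" by blast
  qed
  ultimately show ?thesis
    by blast
qed

end

abbreviation exc_u :: "('k::field \<times> 'k) set" where "exc_u \<equiv> {w. fst w = 0}"
abbreviation exc_V :: "('k::field \<times> 'k) set" where "exc_V \<equiv> {w. snd w = 0}"

lemma subst_uv_expansion:
  fixes h :: "'k::field_char_0 ratfun"
  assumes "has_val h (a, b) c"
  obtains k where "subst h (cst a + var_y) (cst b + var_y * var_z) = cst c + var_y * k"
    "regular_on exc_u k"
proof -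
  have "has_val var_y w 0" if "w \<in> exc_u" for w :: "'k \<times> 'k"
    using has_val_var_y[of w] that by simp
  moreover have "cst a + var_y = cst a + var_y * 1" "regular_on exc_u (1 :: 'k ratfun)"
    using regular_on_cst[of exc_u "1 :: 'k"] by simp_all
  ultimately have "\<exists>k. subst h (cst a + var_y) (cst b + var_y * var_z) = cst c + var_y * k
      \<and> regular_on exc_u k"
    by (rule subst_expansion[OF _ _ _ refl regular_on_var(2) assms dominant_blowup_uv])
  thus ?thesis
    using that by blast
qed

lemma subst_UV_expansion:
  fixes h :: "'k::field_char_0 ratfun"
  assumes "has_val h (a, b) c"
  obtains k where "subst h (cst a + var_y * var_z) (cst b + var_z) = cst c + var_z * k"
    "regular_on exc_V k"
proof -
  have "has_val var_z w 0" if "w \<in> exc_V" for w :: "'k \<times> 'k"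
    using has_val_var_z[of w] that by simp
  moreover have "cst b + var_z = cst b + var_z * 1" "regular_on exc_V (1 :: 'k ratfun)"
    using regular_on_cst[of exc_V "1 :: 'k"] by simp_all
  ultimately have "\<exists>k. subst h (cst a + var_y * var_z) (cst b + var_z) = cst c + var_z * k
      \<and> regular_on exc_V k"
    by (intro subst_expansion[of exc_V var_z _ _ var_y, OF _ _ regular_on_var(1) _ _ assms dominant_blowup_UV])
      (auto simp: mult.commute)
  thus ?thesis
    using that by blast
qed


subsection \<open>Base points\<close>

text \<open>The two local coordinates are linearly independent modulo the square of the maximal
  ideal. To see this, blow up the point, divide by \<open>var_y\<close> and restrict to the
  exceptional curve: \<open>c + v * e = 0\<close> for all \<open>v\<close>.\<close>

lemma linear_terms_vanish:
  fixes p r :: "'k::field_char_0 ratfun"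
  assumes p: "has_val p (a, b) c" and r: "has_val r (a, b) e"
    and zero: "(var_y - cst a) * p + (var_z - cst b) * r = 0"
  shows "c = 0" "e = 0"
proof -
  note dom = dominant_blowup_uv[of a b]
  obtain k where k: "subst p (cst a + var_y) (cst b + var_y * var_z) = cst c + var_y * k"
      "regular_on exc_u k"
    using subst_uv_expansion[OF p] by blast
  obtain l where l: "subst r (cst a + var_y) (cst b + var_y * var_z) = cst e + var_y * l"
      "regular_on exc_u l"
    using subst_uv_expansion[OF r] by blast
  have "subst ((var_y - cst a) * p + (var_z - cst b) * r)
      (cst a + var_y) (cst b + var_y * var_z) = 0"
    unfolding zero by (simp add: subst_base)
  hence "var_y * (cst c + var_y * k + var_z * (cst e + var_y * l)) = 0"
    unfolding subst_simps[OF dom] k(1) l(1) by (simp add: algebra_simps)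
  hence 0: "cst c + var_y * k + var_z * (cst e + var_y * l) = 0"
    by simp
  have "c + v * e = 0" for v
  proof -
    obtain k0 where k0: "has_val k (0, v) k0"
      using k(2) unfolding regular_on_def by fastforce
    obtain l0 where l0: "has_val l (0, v) l0"
      using l(2) unfolding regular_on_def by fastforce
    have "has_val (cst c + var_y * k + var_z * (cst e + var_y * l)) (0, v) (c + v * e)"
      by (rule has_val_cong, (rule has_val_intros k0 l0)+) simp
    thus ?thesis
      unfolding 0 using has_val_unique has_val_0 by blast
  qed
  from this[of 0] this[of 1] show "c = 0" "e = 0"
    by auto
qed

lemma not_indeterminate_if_val:
  fixes h :: "'k::field_gcd ratfun"
  shows "has_val h w c \<Longrightarrow> \<not> indeterminate_at h w"
  by (auto simp: indeterminate_at_iff)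

lemma not_indeterminate_if_inverse_val:
  fixes h :: "'k::field_gcd ratfun"
  shows "has_val (1 / h) w c \<Longrightarrow> \<not> indeterminate_at h w"
  by (auto simp: indeterminate_at_iff)

lemma not_indeterminate_divide:
  fixes f g :: "'k::field_gcd ratfun"
  assumes "has_val f w c" "has_val g w d" "c \<noteq> 0 \<or> d \<noteq> 0"
  shows "\<not> indeterminate_at (f / g) w"
proof (cases "d = 0")
  case True
  with assms(3) have "has_val (g / f) w (d / c)"
    by (intro has_val_divide assms) auto
  moreover have "g / f = 1 / (f / g)"
    by simp
  ultimately show ?thesis
    using not_indeterminate_if_inverse_val by metis
next
  case False
  thus ?thesis
    using has_val_divide[OF assms(1,2)] not_indeterminate_if_val by blast
qed

lemma not_has_val_divide:
  assumes "has_val f w c" "has_val g w 0" "c \<noteq> 0" "g \<noteq> 0"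
  shows "\<not> has_val (f / g) w d"
proof (rule not_has_val_if_pole)
  have "f \<noteq> 0"
    using assms(1,3) has_val_unique[OF _ has_val_0] by blast
  thus "f / g \<noteq> 0"
    using assms(4) by simp
  have "has_val (g / f) w (0 / c)"
    by (intro has_val_divide assms)
  thus "has_val (1 / (f / g)) w 0"
    by simp
qed

text \<open>If the quotient had a value \<open>e\<close>, the linear part of the numerator would be
  \<open>e\<close> times that of the denominator, but the determinant says that the two are
  independent. The same argument excludes a value of the reciprocal.\<close>

lemma indeterminate_divide:
  fixes p r p' r' :: "'k::{field_gcd, field_char_0} ratfun"
  assumes p: "has_val p (a, b) c" and r: "has_val r (a, b) d"
    and p': "has_val p' (a, b) c'" and r': "has_val r' (a, b) d'"
    and det: "c * d' \<noteq> c' * d"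
  shows "indeterminate_at (((var_y - cst a) * p + (var_z - cst b) * r) /
    ((var_y - cst a) * p' + (var_z - cst b) * r')) (a, b)"
proof -
  define Y Z where "Y = (var_y - cst a :: 'k ratfun)" and "Z = (var_z - cst b :: 'k ratfun)"
  \<comment> \<open>Stated for arbitrary data, so that it can be used again with numerator and
    denominator exchanged.\<close>
  have aux: False
    if "has_val p (a, b) c" "has_val r (a, b) d" "has_val p' (a, b) c'" "has_val r' (a, b) d'"
      "c * d' \<noteq> c' * d" "has_val ((Y * p + Z * r) / (Y * p' + Z * r')) (a, b) e"
    for p r p' r' :: "'k ratfun" and c d c' d' e
  proof -
    define h where "h = (Y * p + Z * r) / (Y * p' + Z * r')"
    have h: "has_val h (a, b) e"
      using that by (simp add: h_def)
    have "Y * p' + Z * r' \<noteq> 0"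
      using linear_terms_vanish[OF that(3,4)] that(5) unfolding Y_def Z_def by auto
    hence "Y * p + Z * r = h * (Y * p' + Z * r')"
      by (simp add: h_def)
    hence "Y * (p - h * p') + Z * (r - h * r') = 0"
      by (simp add: algebra_simps)
    hence "c - e * c' = 0" "d - e * d' = 0"
      unfolding Y_def Z_def using linear_terms_vanish that h has_val_diff has_val_mult by meson+
    thus False
      using that(5) by (simp add: algebra_simps)
  qed
  have "\<not> has_val ((Y * p + Z * r) / (Y * p' + Z * r')) (a, b) e" for e
    using aux[OF p r p' r' det] by blast
  moreover have "\<not> has_val (1 / ((Y * p + Z * r) / (Y * p' + Z * r'))) (a, b) e" for e
    using aux[OF p' r' p r] det by auto
  ultimately show ?thesis
    unfolding indeterminate_at_iff Y_def Z_def by blast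
qed

section \<open>Stages of a cascade with at most one new base point\<close>

lemma resolved_iff_uv:
  assumes "new_base_uv \<delta> w S = {b}" "new_base_UV \<delta> w S = {}"
  shows "resolved \<delta> S w \<longleftrightarrow> resolved \<delta> (blowup_uv \<delta> w S) (0, b)"
  using assms by (auto elim: resolved.cases intro: resolved.continue)

lemma resolved_iff_UV:
  assumes "new_base_uv \<delta> w S = {}" "new_base_UV \<delta> w S = {a}"
  shows "resolved \<delta> S w \<longleftrightarrow> resolved \<delta> (blowup_UV \<delta> w S) (a, 0)"
  using assms by (auto elim: resolved.cases intro: resolved.continue)

lemma resolved_iff_final:
  assumes "new_base_uv \<delta> w S = {}" "new_base_UV \<delta> w S = {}"
  shows "resolved \<delta> S w \<longleftrightarrow>
    (\<forall>b. regular_at (blowup_uv \<delta> w S) (0, b)) \<or> (\<forall>a. regular_at (blowup_UV \<delta> w S) (a, 0))"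
  using assms by (auto elim: resolved.cases intro: resolved.final)

lemma regular_onE:
  assumes "regular_on E k" "w \<in> E"
  obtains c where "has_val k w c"
  using assms unfolding regular_on_def by blast


text \<open>The blow-up contracts the exceptional curve to its centre, so a pull-back is constant
  along it.\<close>

lemma has_val_pull_uv:
  fixes h :: "'k::field_char_0 ratfun"
  assumes "has_val h (a, b) c"
  shows "has_val (subst h (cst a + var_y) (cst b + var_y * var_z)) (0, v) c"
proof -
  obtain k where k: "subst h (cst a + var_y) (cst b + var_y * var_z) = cst c + var_y * k"
      "regular_on exc_u k"
    using subst_uv_expansion[OF assms] by blast
  obtain d where "has_val k (0, v) d"
    using regular_onE[OF k(2), of "(0, v)"] by auto
  thus ?thesis
    unfolding k(1)
    by (intro has_val_cong[OF has_val_add[OF has_val_cst has_val_mult[OF has_val_var_y]]]) auto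
qed

lemma has_val_pull_UV:
  fixes h :: "'k::field_char_0 ratfun"
  assumes "has_val h (a, b) c"
  shows "has_val (subst h (cst a + var_y * var_z) (cst b + var_z)) (u, 0) c"
proof -
  obtain k where k: "subst h (cst a + var_y * var_z) (cst b + var_z) = cst c + var_z * k"
      "regular_on exc_V k"
    using subst_UV_expansion[OF assms] by blast
  obtain d where "has_val k (u, 0) d"
    using regular_onE[OF k(2), of "(u, 0)"] by auto
  thus ?thesis
    unfolding k(1)
    by (intro has_val_cong[OF has_val_add[OF has_val_cst has_val_mult[OF has_val_var_z]]]) auto
qed

text \<open>The shape reached when a compatibility condition fails. A further blow-up at the
  crossing of \<open>var_y = 0\<close> and \<open>var_z = 0\<close> removes the indeterminacy, so
  the cascade stops, but each final chart has a component with a double pole along the exceptional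
  curve, because \<open>f\<close> is nonzero.\<close>

lemma not_resolved_node:
  fixes l F :: "'k::{field_gcd, field_char_0} ratfun"
  assumes "\<delta> 0 = 0" and l: "has_val l (0, 0) e" and F: "has_val F (0, 0) f"
    and "f \<noteq> 0" "k \<noteq> 0"
  shows "\<not> resolved \<delta> ((cst k * var_y + var_z * l) / var_z, F / var_y) (0, 0)"
    (is "\<not> resolved \<delta> ?T _")
proof -
  let ?p = "\<lambda>h. subst h (cst 0 + var_y) (cst 0 + var_y * var_z) :: 'k ratfun"
  let ?P = "\<lambda>h. subst h (cst 0 + var_y * var_z) (cst 0 + var_z) :: 'k ratfun"
  have uv: "blowup_uv \<delta> (0, 0) ?T = ((cst k + var_z * ?p l) / var_z,
      (?p F - var_y * (cst k + var_z * ?p l)) / var_y\<^sup>2)"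
    unfolding blowup_uv_def Let_def fst_conv snd_conv assms(1)
      subst_simps[OF dominant_blowup_uv[of 0 0]]
    by (simp add: field_simps power2_eq_square)
  have UV: "blowup_UV \<delta> (0, 0) ?T =
      ((var_z * (cst k * var_y + ?P l) - ?P F) / var_z\<^sup>2, ?P F / (var_y * var_z))"
    unfolding blowup_UV_def Let_def fst_conv snd_conv assms(1)
      subst_simps[OF dominant_blowup_UV[of 0 0]]
    by (simp add: field_simps power2_eq_square)
  have pl: "has_val (?p l) (0, v) e" and pF: "has_val (?p F) (0, v) f" for v
    using has_val_pull_uv[OF l] has_val_pull_uv[OF F] by auto
  have Pl: "has_val (?P l) (u, 0) e" and PF: "has_val (?P F) (u, 0) f" for u
    using has_val_pull_UV[OF l] has_val_pull_UV[OF F] by auto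
  have nF: "has_val (?p F - var_y * (cst k + var_z * ?p l)) (0, v) f" for v
    by (rule has_val_cong, (rule has_val_intros pl pF)+) simp
  have NF: "has_val (var_z * (cst k * var_y + ?P l) - ?P F) (u, 0) (- f)" for u
    by (rule has_val_cong, (rule has_val_intros Pl PF)+) simp
  have yy: "has_val (var_y\<^sup>2) (0, v :: 'k) 0" and zz: "has_val (var_z\<^sup>2) (v :: 'k, 0) 0" for v
    by (rule has_val_cong, (rule has_val_intros)+, simp)+
  have yz: "has_val (var_y * var_z) (v :: 'k, 0) 0" for v
    by (rule has_val_cong, (rule has_val_intros)+, simp)
  have "\<not> indeterminate_at ((cst k + var_z * ?p l) / var_z) (0, v)" for v
  proof (rule not_indeterminate_divide)
    show "has_val (cst k + var_z * ?p l) (0, v) (k + v * e)"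
      by (rule has_val_cong, (rule has_val_intros pl)+) simp
    show "has_val var_z (0, v) v"
      by (rule has_val_cong, rule has_val_var_z) simp
    show "k + v * e \<noteq> 0 \<or> v \<noteq> 0"
      using assms by auto
  qed
  moreover have "\<not> indeterminate_at
      ((?p F - var_y * (cst k + var_z * ?p l)) / var_y\<^sup>2) (0, v)" for v
    using not_indeterminate_divide[OF nF yy] assms by blast
  ultimately have base_uv: "new_base_uv \<delta> (0, 0) ?T = {}"
    unfolding new_base_uv_def base_point_def uv by auto
  have "\<not> indeterminate_at ((var_z * (cst k * var_y + ?P l) - ?P F) / var_z\<^sup>2) (u, 0)" for u
    using not_indeterminate_divide[OF NF zz] assms by simp
  moreover have "\<not> indeterminate_at (?P F / (var_y * var_z)) (u, 0)" for u
    using not_indeterminate_divide[OF PF yz] assms by blast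
  ultimately have base_UV: "new_base_UV \<delta> (0, 0) ?T = {}"
    unfolding new_base_UV_def base_point_def UV by auto
  have "\<not> regular_at (blowup_uv \<delta> (0, 0) ?T) (0, 0)"
    unfolding regular_at_iff uv using not_has_val_divide[OF nF yy] assms by simp
  moreover have "\<not> regular_at (blowup_UV \<delta> (0, 0) ?T) (0, 0)"
    unfolding regular_at_iff UV using not_has_val_divide[OF NF zz] assms by simp
  ultimately show ?thesis
    unfolding resolved_iff_final[OF base_uv base_UV] by blast
qed


subsection \<open>One step of a cascade\<close>

text \<open>The splitting of the numerator into \<open>By\<close> and \<open>Bz\<close> is not
  unique, but the values \<open>y0\<close> and \<open>z0\<close> are, being its linear part at the
  centre. The freedom allows every stage of a concrete cascade to be written conveniently.\<close>

locale cascade_step =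
  fixes \<delta> :: "'k::{field_gcd, field_char_0} \<Rightarrow> 'k" and A By Bz :: "'k ratfun" and b a0 y0 z0 :: 'k
  assumes delta_0 [simp]: "\<delta> 0 = 0"
    and A: "has_val A (0, b) a0" and By: "has_val By (0, b) y0" and Bz: "has_val Bz (0, b) z0"
begin

abbreviation pull_uv where "pull_uv h \<equiv> subst h (cst 0 + var_y) (cst b + var_y * var_z)"
abbreviation pull_UV where "pull_UV h \<equiv> subst h (cst 0 + var_y * var_z) (cst b + var_z)"

lemmas pull_uv_simps = subst_simps[OF dominant_blowup_uv[of 0 b]]
lemmas pull_UV_simps = subst_simps[OF dominant_blowup_UV[of 0 b]]

definition "S = (A, (var_y * By + (var_z - cst b) * Bz) / var_y)"

lemma blowup_uv_S:
  "blowup_uv \<delta> (0, b) S =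
    (pull_uv A, (pull_uv By + var_z * pull_uv Bz - cst (\<delta> b) - var_z * pull_uv A) / var_y)"
  unfolding blowup_uv_def Let_def fst_conv snd_conv S_def pull_uv_simps
  by (simp add: field_simps)

lemma blowup_UV_S:
  "blowup_UV \<delta> (0, b) S =
    ((pull_UV A - var_y * pull_UV By - pull_UV Bz + var_y * cst (\<delta> b)) / var_z,
     (var_y * pull_UV By + pull_UV Bz - var_y * cst (\<delta> b)) / var_y)"
  unfolding blowup_UV_def Let_def fst_conv snd_conv S_def pull_UV_simps
  by (simp add: field_simps)

lemma expansions:
  obtains kA ky kz where
    "pull_uv A = cst a0 + var_y * kA" "pull_uv By = cst y0 + var_y * ky"
    "pull_uv Bz = cst z0 + var_y * kz"
    "regular_on exc_u kA" "regular_on exc_u ky" "regular_on exc_u kz"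
  using subst_uv_expansion[OF A] subst_uv_expansion[OF By] subst_uv_expansion[OF Bz] by metis

lemma expansions_UV:
  obtains kA ky kz where
    "pull_UV A = cst a0 + var_z * kA" "pull_UV By = cst y0 + var_z * ky"
    "pull_UV Bz = cst z0 + var_z * kz"
    "regular_on exc_V kA" "regular_on exc_V ky" "regular_on exc_V kz"
  using subst_UV_expansion[OF A] subst_UV_expansion[OF By] subst_UV_expansion[OF Bz] by metis

lemma pull_uv_val:
  "has_val (pull_uv A) (0, v) a0" "has_val (pull_uv By) (0, v) y0" "has_val (pull_uv Bz) (0, v) z0"
  by (intro has_val_pull_uv A By Bz)+

lemma pull_UV_val:
  "has_val (pull_UV A) (v, 0) a0" "has_val (pull_UV By) (v, 0) y0" "has_val (pull_UV Bz) (v, 0) z0"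
  by (intro has_val_pull_UV A By Bz)+

lemma val_num_uv:
  "has_val (pull_uv By + var_z * pull_uv Bz - cst (\<delta> b) - var_z * pull_uv A) (0, v)
    (y0 + v * z0 - \<delta> b - v * a0)"
  by (rule has_val_cong, (rule has_val_intros pull_uv_val)+) simp

lemma val_num_UV:
  "has_val (pull_UV A - var_y * pull_UV By - pull_UV Bz + var_y * cst (\<delta> b)) (u, 0)
    (a0 - u * y0 - z0 + u * \<delta> b)"
  by (rule has_val_cong, (rule has_val_intros pull_UV_val)+) simp

lemma val_num_UV2:
  "has_val (var_y * pull_UV By + pull_UV Bz - var_y * cst (\<delta> b)) (u, 0)
    (u * y0 + z0 - u * \<delta> b)"
  by (rule has_val_cong, (rule has_val_intros pull_UV_val)+) simp

text \<open>On the exceptional curve the numerator of the second component is the affine function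
  \<open>y0 - \<delta> b + v * (z0 - a0)\<close> of \<open>v\<close>, and its zero is the only
  candidate. It is a base point because the coefficient \<open>z0 - a0\<close> makes the linear
  parts of numerator and denominator independent.\<close>

lemma base_uv_iff:
  assumes "z0 \<noteq> a0"
  shows "base_point (blowup_uv \<delta> (0, b) S) (0, v) \<longleftrightarrow> v = (\<delta> b - y0) / (z0 - a0)"
proof
  assume "base_point (blowup_uv \<delta> (0, b) S) (0, v)"
  hence "indeterminate_at
      ((pull_uv By + var_z * pull_uv Bz - cst (\<delta> b) - var_z * pull_uv A) / var_y) (0, v)"
    unfolding base_point_def blowup_uv_S fst_conv snd_conv
    using not_indeterminate_if_val[OF pull_uv_val(1)] by blast
  hence "y0 + v * z0 - \<delta> b - v * a0 = 0"
    using not_indeterminate_divide[OF val_num_uv has_val_var_y] by blast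
  thus "v = (\<delta> b - y0) / (z0 - a0)"
    using assms by (simp add: field_simps)
next
  assume v: "v = (\<delta> b - y0) / (z0 - a0)"
  obtain kA ky kz where k: "pull_uv A = cst a0 + var_y * kA" "pull_uv By = cst y0 + var_y * ky"
      "pull_uv Bz = cst z0 + var_y * kz"
      "regular_on exc_u kA" "regular_on exc_u ky" "regular_on exc_u kz"
    by (rule expansions)
  \<comment> \<open>\<open>l\<close> collects the terms of first order in \<open>var_y\<close>; any
    value of it at the point will do.\<close>
  define l where "l = ky + var_z * (kz - kA)"
  have "regular_on exc_u l"
    unfolding l_def by (intro regular_on_intros k)
  then obtain c where c: "has_val l (0, v) c"
    by (rule regular_onE[where w = "(0, v)"]) auto
  have "v * (z0 - a0) = \<delta> b - y0"
    using v assms by simp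
  hence "cst v * cst (z0 - a0) = cst (\<delta> b) - cst y0"
    by (simp flip: cst_mult cst_diff)
  hence "pull_uv By + var_z * pull_uv Bz - cst (\<delta> b) - var_z * pull_uv A =
      (var_y - cst 0) * l + (var_z - cst v) * cst (z0 - a0)"
    unfolding k(1-3) l_def by (simp add: algebra_simps cst_diff)
  moreover have "var_y = (var_y - cst 0) * 1 + (var_z - cst v) * (0 :: 'k ratfun)"
    by simp
  ultimately show "base_point (blowup_uv \<delta> (0, b) S) (0, v)"
    unfolding base_point_def blowup_uv_S
    using indeterminate_divide[OF c has_val_cst[of "z0 - a0"] has_val_1 has_val_0] assms by auto
qed

text \<open>The second component is never 0/0: its denominator is nonzero for
  \<open>u \<noteq> 0\<close>, and at \<open>u = 0\<close> its numerator is \<open>z0\<close>. Only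
  the first component can cause a base point.\<close>

lemma base_UV:
  assumes "base_point (blowup_UV \<delta> (0, b) S) (u, 0)" "z0 \<noteq> 0"
  shows "a0 - u * y0 - z0 + u * \<delta> b = 0"
proof -
  have "\<not> indeterminate_at ((var_y * pull_UV By + pull_UV Bz - var_y * cst (\<delta> b)) / var_y) (u, 0)"
    using assms(2) by (intro not_indeterminate_divide[OF val_num_UV2 has_val_var_y]) auto
  hence "indeterminate_at
      ((pull_UV A - var_y * pull_UV By - pull_UV Bz + var_y * cst (\<delta> b)) / var_z) (u, 0)"
    using assms(1) unfolding base_point_def blowup_UV_S by simp
  thus ?thesis
    using not_indeterminate_divide[OF val_num_UV has_val_var_z] by blast
qed

text \<open>The cascade does not branch: \<open>z0 \<noteq> a0\<close> excludes the origin of the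
  second chart, and every other base point there is the one already found in the first
  chart.\<close>

lemma resolved_step:
  assumes "z0 \<noteq> 0" "z0 \<noteq> a0"
  shows "resolved \<delta> S (0, b) \<longleftrightarrow>
    resolved \<delta> (blowup_uv \<delta> (0, b) S) (0, (\<delta> b - y0) / (z0 - a0))"
proof (rule resolved_iff_uv)
  show uv: "new_base_uv \<delta> (0, b) S = {(\<delta> b - y0) / (z0 - a0)}"
    unfolding new_base_uv_def using base_uv_iff[OF assms(2)] by auto
  have "u \<noteq> 0 \<and> 1 / u = (\<delta> b - y0) / (z0 - a0)"
    if "base_point (blowup_UV \<delta> (0, b) S) (u, 0)" for u
  proof -
    have eq: "a0 - u * y0 - z0 + u * \<delta> b = 0"
      using base_UV[OF that assms(1)] .
    hence "u \<noteq> 0"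
      using assms(2) by auto
    with eq show ?thesis
      using assms(2) by (simp add: field_simps)
  qed
  thus "new_base_UV \<delta> (0, b) S = {}"
    unfolding new_base_UV_def uv by blast
qed

context
  assumes final: "z0 = a0" "a0 \<noteq> 0"
begin

text \<open>For \<open>z0 = a0\<close> the terms linear in \<open>var_z\<close> cancel, so the
  numerator is the constant \<open>y0 - \<delta> b\<close> along the exceptional curve: a pole along
  the whole curve, or none.\<close>

lemma blowup_uv_final:
  obtains l where "blowup_uv \<delta> (0, b) S = (pull_uv A, (cst (y0 - \<delta> b) + var_y * l) / var_y)"
    "regular_on exc_u l"
proof -
  obtain kA ky kz where k: "pull_uv A = cst a0 + var_y * kA" "pull_uv By = cst y0 + var_y * ky"
      "pull_uv Bz = cst z0 + var_y * kz"
      "regular_on exc_u kA" "regular_on exc_u ky" "regular_on exc_u kz"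
    by (rule expansions)
  have "regular_on exc_u (ky + var_z * (kz - kA))"
    by (intro regular_on_intros k)
  moreover have "pull_uv By + var_z * pull_uv Bz - cst (\<delta> b) - var_z * pull_uv A =
      cst (y0 - \<delta> b) + var_y * (ky + var_z * (kz - kA))"
    unfolding k(1-3) final by (simp add: algebra_simps cst_diff)
  ultimately show ?thesis
    using that unfolding blowup_uv_S by metis
qed

lemma blowup_UV_final:
  obtains l where "blowup_UV \<delta> (0, b) S =
      ((cst (\<delta> b - y0) * var_y + var_z * l) / var_z,
       (var_y * pull_UV By + pull_UV Bz - var_y * cst (\<delta> b)) / var_y)"
    "regular_on exc_V l"
proof -
  obtain kA ky kz where k: "pull_UV A = cst a0 + var_z * kA" "pull_UV By = cst y0 + var_z * ky"
      "pull_UV Bz = cst z0 + var_z * kz"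
      "regular_on exc_V kA" "regular_on exc_V ky" "regular_on exc_V kz"
    by (rule expansions_UV)
  have "regular_on exc_V (kA - var_y * ky - kz)"
    by (intro regular_on_intros k)
  moreover have "pull_UV A - var_y * pull_UV By - pull_UV Bz + var_y * cst (\<delta> b) =
      cst (\<delta> b - y0) * var_y + var_z * (kA - var_y * ky - kz)"
    unfolding k(1-3) final by (simp add: algebra_simps cst_diff)
  ultimately show ?thesis
    using that unfolding blowup_UV_S by metis
qed

lemma resolved_if_final:
  assumes "\<delta> b = y0"
  shows "resolved \<delta> S (0, b)"
proof -
  obtain l where l: "blowup_uv \<delta> (0, b) S = (pull_uv A, (cst (y0 - \<delta> b) + var_y * l) / var_y)"
      "regular_on exc_u l"
    by (rule blowup_uv_final)
  obtain m where m: "blowup_UV \<delta> (0, b) S =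
      ((cst (\<delta> b - y0) * var_y + var_z * m) / var_z,
       (var_y * pull_UV By + pull_UV Bz - var_y * cst (\<delta> b)) / var_y)" "regular_on exc_V m"
    by (rule blowup_UV_final)
  have uv: "blowup_uv \<delta> (0, b) S = (pull_uv A, l)"
    using assms l(1) by simp
  have UV: "blowup_UV \<delta> (0, b) S =
      (m, (var_y * pull_UV By + pull_UV Bz - var_y * cst (\<delta> b)) / var_y)"
    using assms m(1) by simp
  have l_val: "\<exists>c. has_val l (0, v) c" for v
    using l(2) by (simp add: regular_on_def)
  have "\<not> base_point (blowup_uv \<delta> (0, b) S) (0, v)" for v
    unfolding base_point_def uv using l_val[of v] pull_uv_val(1)[of v] not_indeterminate_if_val
    by fastforce
  moreover have "\<not> base_point (blowup_UV \<delta> (0, b) S) (u, 0)" for u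
  proof -
    have "\<exists>c. has_val m (u, 0) c"
      using m(2) by (simp add: regular_on_def)
    moreover have "\<not> indeterminate_at
        ((var_y * pull_UV By + pull_UV Bz - var_y * cst (\<delta> b)) / var_y) (u, 0)"
      using final by (intro not_indeterminate_divide[OF val_num_UV2 has_val_var_y]) auto
    ultimately show ?thesis
      unfolding base_point_def UV using not_indeterminate_if_val by fastforce
  qed
  moreover have "\<forall>v. regular_at (blowup_uv \<delta> (0, b) S) (0, v)"
    unfolding regular_at_iff uv using l_val pull_uv_val(1) by fastforce
  ultimately show ?thesis
    by (intro resolved.final) (auto simp: new_base_uv_def new_base_UV_def)
qed

text \<open>The first chart has a pole along the whole exceptional curve and no base point. The
  second one has a base point at the origin, where the exceptional curve meets the proper transform
  of \<open>var_y = 0\<close>; the cascade continues there and fails by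
  \<open>not_resolved_node\<close>.\<close>

lemma not_resolved_if_final:
  assumes "\<delta> b \<noteq> y0"
  shows "\<not> resolved \<delta> S (0, b)"
proof -
  obtain l where uv: "blowup_uv \<delta> (0, b) S = (pull_uv A, (cst (y0 - \<delta> b) + var_y * l) / var_y)"
      "regular_on exc_u l"
    by (rule blowup_uv_final)
  define F where "F = var_y * pull_UV By + pull_UV Bz - var_y * cst (\<delta> b)"
  obtain m where UV: "blowup_UV \<delta> (0, b) S =
      ((cst (\<delta> b - y0) * var_y + var_z * m) / var_z, F / var_y)" "regular_on exc_V m"
    unfolding F_def by (rule blowup_UV_final)
  have base_uv: "new_base_uv \<delta> (0, b) S = {}"
  proof -
    have "\<not> base_point (blowup_uv \<delta> (0, b) S) (0, v)" for v
    proof -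
      obtain d where d: "has_val l (0, v) d"
        using regular_onE[OF uv(2), of "(0, v)"] by auto
      have "has_val (cst (y0 - \<delta> b) + var_y * l) (0, v) (y0 - \<delta> b)"
        by (rule has_val_cong, (rule has_val_intros d)+) simp
      hence "\<not> indeterminate_at ((cst (y0 - \<delta> b) + var_y * l) / var_y) (0, v)"
        using assms by (intro not_indeterminate_divide[OF _ has_val_var_y]) auto
      thus ?thesis
        unfolding base_point_def uv(1) fst_conv snd_conv
        using not_indeterminate_if_val[OF pull_uv_val(1)] by blast
    qed
    thus ?thesis
      by (simp add: new_base_uv_def)
  qed
  have F: "has_val F (0, 0) a0"
    unfolding F_def using val_num_UV2[of 0] final by simp
  obtain e where e: "has_val m (0, 0) e"
    using regular_onE[OF UV(2), of "(0, 0)"] by auto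
  have "base_point (blowup_UV \<delta> (0, b) S) (u, 0) \<longleftrightarrow> u = 0" for u
  proof
    assume base: "base_point (blowup_UV \<delta> (0, b) S) (u, 0)"
    have "a0 - u * y0 - z0 + u * \<delta> b = 0"
      using final by (intro base_UV[OF base]) simp
    hence "u * (\<delta> b - y0) = 0"
      using final by (simp add: algebra_simps)
    thus "u = 0"
      using assms by simp
  next
    assume [simp]: "u = 0"
    have "indeterminate_at (((var_y - cst 0) * cst (\<delta> b - y0) + (var_z - cst 0) * m) /
        ((var_y - cst 0) * 0 + (var_z - cst 0) * 1)) (0, 0)"
      by (rule indeterminate_divide[OF has_val_cst e has_val_0 has_val_1]) (use assms in simp)
    thus "base_point (blowup_UV \<delta> (0, b) S) (u, 0)"
      unfolding base_point_def UV by (simp add: mult.commute)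
  qed
  hence base_UV: "new_base_UV \<delta> (0, b) S = {0}"
    unfolding new_base_UV_def base_uv by auto
  have "resolved \<delta> S (0, b) \<longleftrightarrow> resolved \<delta> (blowup_UV \<delta> (0, b) S) (0, 0)"
    by (rule resolved_iff_UV[OF base_uv base_UV])
  also have "\<not> \<dots>"
    unfolding UV(1) using assms final
    by (intro not_resolved_node[where e = e and f = a0] delta_0 e F) auto
  finally show ?thesis .
qed

lemma resolved_final_iff: "resolved \<delta> S (0, b) \<longleftrightarrow> \<delta> b = y0"
  using resolved_if_final not_resolved_if_final by blast

end

end


text \<open>The mirror image, with exceptional curve \<open>z = 0\<close>. Only centres at the origin are needed: any
  other new base point is visible in the first chart of its blow-up and hence belongs there.\<close>

locale cascade_step_mirror =
  fixes \<delta> :: "'k::{field_gcd, field_char_0} \<Rightarrow> 'k" and A By Bz :: "'k ratfun" and a0 y0 z0 :: 'k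
  assumes delta_0 [simp]: "\<delta> 0 = 0"
    and A: "has_val A (0, 0) a0" and By: "has_val By (0, 0) y0" and Bz: "has_val Bz (0, 0) z0"
    and y0: "y0 \<noteq> 0"
begin

abbreviation pull_uv where "pull_uv h \<equiv> subst h (cst 0 + var_y) (cst 0 + var_y * var_z)"
abbreviation pull_UV where "pull_UV h \<equiv> subst h (cst 0 + var_y * var_z) (cst 0 + var_z)"

lemmas pull_uv_simps = subst_simps[OF dominant_blowup_uv[of 0 0]]
lemmas pull_UV_simps = subst_simps[OF dominant_blowup_UV[of 0 0]]

definition "S = ((var_y * By + var_z * Bz) / var_z, A)"

lemma blowup_uv_S:
  "blowup_uv \<delta> (0, 0) S =
    ((pull_uv By + var_z * pull_uv Bz) / var_z,
     (pull_uv A - pull_uv By - var_z * pull_uv Bz) / var_y)"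
  unfolding blowup_uv_def Let_def fst_conv snd_conv S_def pull_uv_simps
  by (simp add: field_simps)

lemma blowup_UV_S:
  "blowup_UV \<delta> (0, 0) S =
    ((var_y * pull_UV By + pull_UV Bz - var_y * pull_UV A) / var_z, pull_UV A)"
  unfolding blowup_UV_def Let_def fst_conv snd_conv S_def pull_UV_simps
  by (simp add: field_simps)

lemma pull_uv_val:
  "has_val (pull_uv A) (0, v) a0" "has_val (pull_uv By) (0, v) y0" "has_val (pull_uv Bz) (0, v) z0"
  by (intro has_val_pull_uv A By Bz)+

lemma pull_UV_val:
  "has_val (pull_UV A) (v, 0) a0" "has_val (pull_UV By) (v, 0) y0" "has_val (pull_UV Bz) (v, 0) z0"
  by (intro has_val_pull_UV A By Bz)+

lemma first_component_uv:
  "\<not> indeterminate_at ((pull_uv By + var_z * pull_uv Bz) / var_z) (0, v)"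
proof (rule not_indeterminate_divide)
  show "has_val (pull_uv By + var_z * pull_uv Bz) (0, v) (y0 + v * z0)"
    by (rule has_val_cong, (rule has_val_intros pull_uv_val)+) simp
  show "has_val var_z (0, v) v"
    by (rule has_val_cong, rule has_val_var_z) simp
  show "y0 + v * z0 \<noteq> 0 \<or> v \<noteq> 0"
    using y0 by auto
qed

lemma base_uv:
  assumes "base_point (blowup_uv \<delta> (0, 0) S) (0, v)"
  shows "a0 - y0 - v * z0 = 0"
proof -
  have "indeterminate_at ((pull_uv A - pull_uv By - var_z * pull_uv Bz) / var_y) (0, v)"
    using assms first_component_uv unfolding base_point_def blowup_uv_S by simp
  moreover have "has_val (pull_uv A - pull_uv By - var_z * pull_uv Bz) (0, v) (a0 - y0 - v * z0)"
    by (rule has_val_cong, (rule has_val_intros pull_uv_val)+) simp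
  ultimately show ?thesis
    using not_indeterminate_divide[OF _ has_val_var_y] by blast
qed

lemma base_UV:
  assumes "base_point (blowup_UV \<delta> (0, 0) S) (u, 0)"
  shows "u * (y0 - a0) + z0 = 0"
proof -
  have "indeterminate_at
      ((var_y * pull_UV By + pull_UV Bz - var_y * pull_UV A) / var_z) (u, 0)"
    using assms not_indeterminate_if_val[OF pull_UV_val(1)]
    unfolding base_point_def blowup_UV_S fst_conv snd_conv by blast
  moreover have "has_val (var_y * pull_UV By + pull_UV Bz - var_y * pull_UV A) (u, 0)
      (u * (y0 - a0) + z0)"
    by (rule has_val_cong, (rule has_val_intros pull_UV_val)+) (simp add: algebra_simps)
  ultimately show ?thesis
    using not_indeterminate_divide[OF _ has_val_var_z] by blast
qed

text \<open>For \<open>z0 = 0\<close> the new base point is the origin of the second chart, which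
  the first one does not show. The pull-back of \<open>Bz\<close> is divisible by
  \<open>var_z\<close>, so the next stage is again of mirrored form, with \<open>y0\<close> lowered
  by \<open>a0\<close>.\<close>

lemma resolved_step_0:
  assumes "z0 = 0" "y0 \<noteq> a0"
  shows "resolved \<delta> S (0, 0) \<longleftrightarrow> resolved \<delta> (blowup_UV \<delta> (0, 0) S) (0, 0)"
proof (rule resolved_iff_UV)
  show uv: "new_base_uv \<delta> (0, 0) S = {}"
    unfolding new_base_uv_def using base_uv assms by auto
  have "base_point (blowup_UV \<delta> (0, 0) S) (u, 0) \<longleftrightarrow> u = 0" for u
  proof
    assume "base_point (blowup_UV \<delta> (0, 0) S) (u, 0)"
    from base_UV[OF this] show "u = 0"
      using assms by simp
  next
    assume [simp]: "u = 0"
    obtain kA where kA: "pull_UV A = cst a0 + var_z * kA" "regular_on exc_V kA"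
      using subst_UV_expansion[OF A] by blast
    obtain ky where ky: "pull_UV By = cst y0 + var_z * ky" "regular_on exc_V ky"
      using subst_UV_expansion[OF By] by blast
    obtain kz where kz: "pull_UV Bz = cst z0 + var_z * kz" "regular_on exc_V kz"
      using subst_UV_expansion[OF Bz] by blast
    define l where "l = var_y * ky + kz - var_y * kA"
    have "regular_on exc_V l"
      unfolding l_def by (intro regular_on_intros kA ky kz)
    then obtain c where c: "has_val l (0, 0) c"
      by (rule regular_onE[where w = "(0, 0)"]) auto
    have "indeterminate_at (((var_y - cst 0) * cst (y0 - a0) + (var_z - cst 0) * l) /
        ((var_y - cst 0) * 0 + (var_z - cst 0) * 1)) (0, 0)"
      by (rule indeterminate_divide[OF has_val_cst c has_val_0 has_val_1]) (use assms in simp)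
    moreover have "(var_y - cst 0) * cst (y0 - a0) + (var_z - cst 0) * l =
        var_y * pull_UV By + pull_UV Bz - var_y * pull_UV A"
      unfolding kA ky kz l_def assms(1) by (simp add: algebra_simps cst_diff)
    ultimately show "base_point (blowup_UV \<delta> (0, 0) S) (u, 0)"
      unfolding base_point_def blowup_UV_S by simp
  qed
  thus "new_base_UV \<delta> (0, 0) S = {0}"
    unfolding new_base_UV_def uv by auto
qed

text \<open>For \<open>z0 \<noteq> 0\<close> the new base point lies in the first chart at a nonzero
  height, where the denominator \<open>var_z\<close> is a unit. The cascade leaves the mirrored form
  here and continues in that of \<open>cascade_step\<close>.\<close>

lemma resolved_step:
  assumes "z0 \<noteq> 0" "y0 \<noteq> a0"
  shows "resolved \<delta> S (0, 0) \<longleftrightarrow>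
    resolved \<delta> (blowup_uv \<delta> (0, 0) S) (0, (a0 - y0) / z0)"
proof (rule resolved_iff_uv)
  have "base_point (blowup_uv \<delta> (0, 0) S) (0, v) \<longleftrightarrow> v = (a0 - y0) / z0" for v
  proof
    assume "base_point (blowup_uv \<delta> (0, 0) S) (0, v)"
    from base_uv[OF this] show "v = (a0 - y0) / z0"
      using assms by (simp add: field_simps)
  next
    assume v: "v = (a0 - y0) / z0"
    obtain kA where kA: "pull_uv A = cst a0 + var_y * kA" "regular_on exc_u kA"
      using subst_uv_expansion[OF A] by blast
    obtain ky where ky: "pull_uv By = cst y0 + var_y * ky" "regular_on exc_u ky"
      using subst_uv_expansion[OF By] by blast
    obtain kz where kz: "pull_uv Bz = cst z0 + var_y * kz" "regular_on exc_u kz"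
      using subst_uv_expansion[OF Bz] by blast
    define l where "l = kA - ky - var_z * kz"
    have "regular_on exc_u l"
      unfolding l_def by (intro regular_on_intros kA ky kz)
    then obtain c where c: "has_val l (0, v) c"
      by (rule regular_onE[where w = "(0, v)"]) auto
    have "cst v * cst z0 = cst a0 - cst y0"
      using v assms(1) by (simp flip: cst_mult cst_diff)
    hence "(var_y - cst 0) * l + (var_z - cst v) * cst (- z0) =
        pull_uv A - pull_uv By - var_z * pull_uv Bz"
      unfolding kA ky kz l_def by (simp add: algebra_simps cst_minus)
    moreover have "indeterminate_at (((var_y - cst 0) * l + (var_z - cst v) * cst (- z0)) /
        ((var_y - cst 0) * 1 + (var_z - cst v) * 0)) (0, v)"
      by (rule indeterminate_divide[OF c has_val_cst has_val_1 has_val_0]) (use assms in simp)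
    ultimately show "base_point (blowup_uv \<delta> (0, 0) S) (0, v)"
      unfolding base_point_def blowup_uv_S by simp
  qed
  thus uv: "new_base_uv \<delta> (0, 0) S = {(a0 - y0) / z0}"
    unfolding new_base_uv_def by auto
  have "u \<noteq> 0 \<and> 1 / u = (a0 - y0) / z0" if "base_point (blowup_UV \<delta> (0, 0) S) (u, 0)" for u
  proof -
    have eq: "u * (y0 - a0) + z0 = 0"
      using base_UV[OF that] .
    hence "u \<noteq> 0"
      using assms(1) by auto
    with eq show ?thesis
      using assms by (simp add: field_simps)
  qed
  thus "new_base_UV \<delta> (0, 0) S = {}"
    unfolding new_base_UV_def uv by blast
qed

text \<open>Regularity on the whole curve is visible in the second chart only: in the first one, the
  first component still has a pole at the origin, since \<open>y0\<close> is nonzero.\<close>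

lemma resolved_final:
  assumes "y0 = a0" "Bz = 0"
  shows "resolved \<delta> S (0, 0)"
proof -
  obtain kA where kA: "pull_uv A = cst a0 + var_y * kA" "regular_on exc_u kA"
    using subst_uv_expansion[OF A] by blast
  obtain ky where ky: "pull_uv By = cst y0 + var_y * ky" "regular_on exc_u ky"
    using subst_uv_expansion[OF By] by blast
  obtain lA where lA: "pull_UV A = cst a0 + var_z * lA" "regular_on exc_V lA"
    using subst_UV_expansion[OF A] by blast
  obtain ly where ly: "pull_UV By = cst y0 + var_z * ly" "regular_on exc_V ly"
    using subst_UV_expansion[OF By] by blast
  have uv: "snd (blowup_uv \<delta> (0, 0) S) = kA - ky"
    unfolding blowup_uv_S snd_conv unfolding kA ky assms by (simp add: subst_base field_simps)
  have UV: "blowup_UV \<delta> (0, 0) S = (var_y * (ly - lA), pull_UV A)"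
    unfolding blowup_UV_S unfolding lA ly assms by (simp add: subst_base field_simps)
  have reg: "\<exists>c. has_val (kA - ky) (0, v) c" for v
    using regular_on_diff[OF kA(2) ky(2)] by (simp add: regular_on_def)
  have "regular_on exc_V (var_y * (ly - lA))"
    by (intro regular_on_intros lA ly)
  hence reg': "\<exists>c. has_val (var_y * (ly - lA)) (u, 0) c" for u
    by (simp add: regular_on_def)
  have "\<not> indeterminate_at (fst (blowup_uv \<delta> (0, 0) S)) (0, v)" for v
    unfolding blowup_uv_S fst_conv by (rule first_component_uv)
  moreover have "\<not> indeterminate_at (snd (blowup_uv \<delta> (0, 0) S)) (0, v)" for v
    unfolding uv using reg[of v] not_indeterminate_if_val by blast
  ultimately have "new_base_uv \<delta> (0, 0) S = {}"
    by (simp add: new_base_uv_def base_point_def)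
  moreover have "\<not> base_point (blowup_UV \<delta> (0, 0) S) (u, 0)" for u
    unfolding base_point_def UV fst_conv snd_conv
    using reg'[of u] pull_UV_val(1)[of u] not_indeterminate_if_val by blast
  moreover have "regular_at (blowup_UV \<delta> (0, 0) S) (u, 0)" for u
    unfolding regular_at_iff UV fst_conv snd_conv using reg' pull_UV_val(1) by blast
  ultimately show ?thesis
    by (intro resolved.final) (auto simp: new_base_UV_def)
qed

end


subsection \<open>The cascades of the modified system XIII\<close>

locale derivation =
  fixes \<delta> :: "'k::field_char_0 \<Rightarrow> 'k"
  assumes delta_add: "\<delta> (a + b) = \<delta> a + \<delta> b"
    and delta_mult: "\<delta> (a * b) = a * \<delta> b + \<delta> a * b"
begin

lemma delta_0 [simp]: "\<delta> 0 = 0"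
  using delta_add[of 0 0] by simp

lemma delta_1 [simp]: "\<delta> 1 = 0"
  using delta_mult[of 1 1] by simp

lemma delta_minus: "\<delta> (- a) = - \<delta> a"
  using delta_add[of a "- a"] by (simp add: eq_neg_iff_add_eq_0 add.commute)

lemma delta_diff: "\<delta> (a - b) = \<delta> a - \<delta> b"
  using delta_add[of a "- b"] by (simp add: delta_minus)

lemma delta_of_nat [simp]: "\<delta> (of_nat n) = 0"
  by (induction n) (simp_all add: delta_add)

lemma delta_numeral [simp]: "\<delta> (numeral n) = 0"
  using delta_of_nat[of "numeral n"] by simp

lemma delta_power2: "\<delta> (a\<^sup>2) = 2 * a * \<delta> a"
  by (simp add: power2_eq_square delta_mult)

lemma delta_divide:
  assumes "b \<noteq> 0"
  shows "\<delta> (a / b) = (\<delta> a * b - a * \<delta> b) / b\<^sup>2"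
proof -
  have "\<delta> a = \<delta> (a / b) * b + (a / b) * \<delta> b"
    using delta_mult[of "a / b" b] assms by simp
  thus ?thesis
    using assms by (simp add: field_simps power2_eq_square)
qed

lemma delta_divide_const: "\<delta> b = 0 \<Longrightarrow> \<delta> (a / b) = \<delta> a / b"
  by (cases "b = 0") (simp_all add: delta_divide power2_eq_square)

lemmas delta_simps = delta_add delta_mult delta_minus delta_diff delta_power2

end

text \<open>The parameters stand for \<open>\<beta> = a\<^sub>2/a\<^sub>1\<close>, \<open>\<gamma> = a\<^sub>1\<close> and \<open>\<sigma> = (2 q\<^sup>2 + 2 q' + x)/\<beta>\<close>; \<open>X\<close> is \<open>x\<close>.\<close>

text \<open>The scalar computations are done over a plain field, since the simplifier treats the
  division of a \<open>field_gcd\<close> as a Euclidean one.\<close>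

locale XIII_coefficients = derivation \<delta> for \<delta> :: "'k::field_char_0 \<Rightarrow> 'k" +
  fixes \<beta> \<gamma> q X :: 'k
  assumes beta: "\<beta> \<noteq> 0" "\<delta> \<beta> = 0" and gamma: "\<gamma> \<noteq> 0" "\<delta> \<gamma> = 0" and delta_X: "\<delta> X = 1"
begin

definition "\<sigma> = (2 * q\<^sup>2 + 2 * \<delta> q + X) / \<beta>"

definition "PII_derivative \<longleftrightarrow> \<delta> (\<delta> (\<delta> q)) = 6 * q\<^sup>2 * \<delta> q + q + X * \<delta> q"

text \<open>The centres of the cascade at \<open>(0, \<beta>/(2\<gamma>))\<close> in the chart \<open>(u\<^sub>0, v\<^sub>0)\<close>.\<close>

definition "b1 = - 2 * q / \<gamma>"
definition "b2 = (4 * \<delta> q - \<sigma> * \<beta>) / (2 * \<beta> * \<gamma>)"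
definition "b3 = - 2 * \<delta> b2 / \<beta>"

lemma delta_b0: "\<delta> (\<beta> / (2 * \<gamma>)) = 0"
  using beta gamma by (simp add: delta_divide delta_simps)

text \<open>The recursion for the next centre, solved for the derivative of the present one. In this
  form, as in \<open>delta_b2\<close>, the blow-ups can be computed without expanding the centres in
  terms of \<open>q\<close>.\<close>

lemma delta_b1: "\<delta> b1 = - \<beta> * b2 - \<sigma> * \<beta> / (2 * \<gamma>)"
proof -
  have "\<delta> b1 = - 2 * \<delta> q / \<gamma>"
    using gamma by (simp add: b1_def delta_divide delta_simps power2_eq_square)
  thus ?thesis
    using beta gamma by (simp add: b2_def field_simps)
qed

lemma delta_b2: "\<delta> b2 = - \<beta> * b3 / 2"
  using beta by (simp add: b3_def)

text \<open>The values of \<open>z0\<close> at the four stages, -2\<beta>, -3\<beta>/2, -\<beta> and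
  -\<beta>/2, compared with 0 and with the constant value -\<beta>/2 of \<open>a0\<close>.\<close>

lemma neq:
  "- 2 * \<beta> \<noteq> 0" "- 2 * \<beta> \<noteq> - \<beta> / 2" "- 3 * \<beta> / 2 \<noteq> 0" "- 3 * \<beta> / 2 \<noteq> - \<beta> / 2"
  "- \<beta> \<noteq> 0" "- \<beta> \<noteq> - \<beta> / 2" "- \<beta> / 2 \<noteq> 0"
  using beta by (simp_all add: field_simps)

lemma next_b1: "(0 - (- 3 * q * \<beta> / \<gamma>)) / (- 2 * \<beta> - (- \<beta> / 2)) = b1"
  using beta gamma by (simp add: b1_def field_simps)

lemma next_b2: "(\<delta> b1 - (- \<sigma> * \<beta> / (2 * \<gamma>))) / (- 3 * \<beta> / 2 - (- \<beta> / 2)) = b2"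
  using beta gamma unfolding delta_b1 by (simp add: field_simps)

lemma next_b3: "(\<delta> b2 - 0) / (- \<beta> - (- \<beta> / 2)) = b3"
  using beta unfolding delta_b2 by (simp add: field_simps)

text \<open>Besides \<open>\<sigma> * \<beta> / 2 = \<delta> q + q\<^sup>2 + X / 2\<close> there is
  a second Riccati expression, \<open>t\<close>, with the opposite signs. Up to constant factors
  \<open>b2\<close> and \<open>b3\<close> are \<open>t\<close> and its derivative, so the condition
  becomes an equation of second order for \<open>t\<close>.\<close>

lemma resonance_uv_iff: "\<delta> b3 = 2 * \<gamma> * b2\<^sup>2 + \<sigma> * b2 - 2 * q * b3 \<longleftrightarrow> PII_derivative"
proof -
  define E where "E = \<delta> (\<delta> (\<delta> q)) - (6 * q\<^sup>2 * \<delta> q + q + X * \<delta> q)"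
  define t where "t = \<delta> q - q\<^sup>2 - X / 2"
  have sigma: "\<sigma> * \<beta> = 2 * q\<^sup>2 + 2 * \<delta> q + X"
    using beta by (simp add: \<sigma>_def)
  have b2: "b2 = t / (\<beta> * \<gamma>)"
    using beta gamma unfolding b2_def sigma t_def by (simp add: field_simps)
  have delta_t: "\<delta> t = \<delta> (\<delta> q) - 2 * q * \<delta> q - 1 / 2"
    unfolding t_def by (simp add: delta_simps delta_divide delta_X)
  have delta_delta_t: "\<delta> (\<delta> t) = \<delta> (\<delta> (\<delta> q)) - 2 * (\<delta> q)\<^sup>2 - 2 * q * \<delta> (\<delta> q)"
    unfolding delta_t by (simp add: delta_simps delta_divide power2_eq_square algebra_simps)
  have delta_b2': "\<delta> b2 = \<delta> t / (\<beta> * \<gamma>)"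
    unfolding b2 using beta gamma by (simp add: delta_divide_const delta_simps)
  have b3: "b3 = - 2 * \<delta> t / (\<beta>\<^sup>2 * \<gamma>)"
    unfolding b3_def delta_b2' by (simp add: power2_eq_square)
  have delta_b3: "\<delta> b3 = - 2 * \<delta> (\<delta> t) / (\<beta>\<^sup>2 * \<gamma>)"
    unfolding b3 using beta gamma by (simp add: delta_divide_const delta_simps)
  have "\<delta> b3 - (2 * \<gamma> * b2\<^sup>2 + \<sigma> * b2 - 2 * q * b3) =
      - (2 * \<delta> (\<delta> t) + 2 * t\<^sup>2 + (\<sigma> * \<beta>) * t + 4 * q * \<delta> t) / (\<beta>\<^sup>2 * \<gamma>)"
    unfolding delta_b3 unfolding b3 b2 using beta gamma by (simp add: field_simps power2_eq_square)
  \<comment> \<open>Because \<open>2 * t + \<sigma> * \<beta> = 4 * \<delta> q\<close>, the two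
    middle terms add up to \<open>4 * \<delta> q * t\<close>, and all terms with
    \<open>(\<delta> q)\<^sup>2\<close> and \<open>q * \<delta> (\<delta> q)\<close> cancel.\<close>
  also have "2 * \<delta> (\<delta> t) + 2 * t\<^sup>2 + (\<sigma> * \<beta>) * t + 4 * q * \<delta> t = 2 * E"
    unfolding delta_delta_t unfolding delta_t sigma E_def
    by (simp add: t_def field_simps power2_eq_square)
  finally have "\<delta> b3 - (2 * \<gamma> * b2\<^sup>2 + \<sigma> * b2 - 2 * q * b3) = 0 \<longleftrightarrow> E = 0"
    using beta gamma by simp
  thus ?thesis
    unfolding PII_derivative_def E_def by simp
qed

text \<open>The centres of the second half of the cascade at the origin of the chart \<open>(U\<^sub>0, V\<^sub>0)\<close>,
  meaningful for \<open>\<sigma> \<noteq> 0\<close>.\<close>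

definition "c1 = - 2 * \<gamma> / \<sigma>"
definition "c2 = - 2 * (\<delta> c1 + 2 * q * c1) / \<sigma>"

context
  assumes sigma: "\<sigma> \<noteq> 0"
begin

lemma c1_neq_0: "c1 \<noteq> 0" and sigma_eq: "\<sigma> = - 2 * \<gamma> / c1"
  using sigma gamma by (simp_all add: c1_def)

lemma delta_c1: "\<delta> c1 = \<gamma> * c2 / c1 - 2 * q * c1"
  unfolding c2_def using c1_neq_0 gamma by (subst sigma_eq) (simp add: field_simps)

lemma sigma_neq_half: "- \<sigma> \<noteq> - \<sigma> / 2"
  using sigma by (simp add: field_simps)

lemma next_c1: "(\<gamma> - 3 * \<gamma>) / \<sigma> = c1"
  by (simp add: c1_def)

lemma next_c2: "(\<delta> c1 - (- 2 * q * c1)) / (- \<sigma> - (- \<sigma> / 2)) = c2"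
  using sigma by (simp add: c2_def field_simps)

text \<open>The value of \<open>a0\<close> at the centres \<open>c1\<close> and \<open>c2\<close>,
  in the two shapes in which it arises. Compared with \<open>z0 = - \<sigma>\<close> at
  \<open>c1\<close>, the quotient is 2: two of the four blow-ups remain.\<close>

lemma eigenvalue_c1:
  "(3 * \<gamma> + \<sigma> * c1) / c1 = - \<sigma> / 2" "3 * \<gamma> / c1 + \<sigma> = - \<sigma> / 2"
  using sigma gamma by (simp_all add: c1_def field_simps)

text \<open>\<open>\<beta> * M\<close> is \<open>2 q^3 + X q - q'' - 1/2\<close>, that is
  \<open>- (\<alpha> + 1 / 2)\<close> on solutions of PII, so the differentiated equation says that
  \<open>M\<close> is constant. Since \<open>c2 = 8 \<gamma> M / \<sigma>^3\<close>, the condition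
  then follows from the linear equation \<open>\<delta> \<sigma> = 2 q \<sigma> - 2 M\<close>
  alone.\<close>

lemma resonance_UV:
  assumes PII_derivative
  shows "\<delta> c2 = - 6 * q * c2 + 3 * \<gamma> * c2\<^sup>2 / c1\<^sup>2"
proof -
  define M where "M = q * \<sigma> - \<delta> \<sigma> / 2"
  have delta_sigma: "\<delta> \<sigma> = 2 * q * \<sigma> - 2 * M"
    by (simp add: M_def)
  have s: "\<beta> * \<sigma> = 2 * q\<^sup>2 + 2 * \<delta> q + X"
    using beta by (simp add: \<sigma>_def)
  have "\<delta> (\<beta> * \<sigma>) = 4 * q * \<delta> q + 2 * \<delta> (\<delta> q) + 1"
    unfolding s by (simp add: delta_simps delta_X)
  hence "\<beta> * \<delta> \<sigma> = 4 * q * \<delta> q + 2 * \<delta> (\<delta> q) + 1"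
    using beta by (simp add: delta_mult)
  moreover have "\<beta> * M = q * (\<beta> * \<sigma>) - (\<beta> * \<delta> \<sigma>) / 2"
    by (simp add: M_def algebra_simps)
  ultimately have "\<beta> * M = 2 * (q * q\<^sup>2) + X * q - \<delta> (\<delta> q) - 1 / 2"
    unfolding s by (simp add: field_simps power2_eq_square)
  hence "\<delta> (\<beta> * M) = \<delta> (2 * (q * q\<^sup>2) + X * q - \<delta> (\<delta> q) - 1 / 2)"
    by (rule arg_cong)
  also have "\<dots> = 0"
    using assms by (simp add: delta_simps delta_divide delta_X PII_derivative_def
      algebra_simps power2_eq_square)
  finally have delta_M: "\<delta> M = 0"
    using beta by (simp add: delta_mult)
  have delta_c1': "\<delta> c1 = 2 * \<gamma> * \<delta> \<sigma> / \<sigma>\<^sup>2"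
    unfolding c1_def using sigma gamma by (simp add: delta_divide delta_simps)
  have c2: "c2 = 8 * \<gamma> * M / \<sigma> ^ 3"
    unfolding c2_def delta_c1' unfolding c1_def delta_sigma using sigma
    by (simp add: field_simps power2_eq_square power3_eq_cube)
  have "\<delta> (\<sigma> ^ 3) = 3 * \<sigma>\<^sup>2 * \<delta> \<sigma>"
    by (simp add: power3_eq_cube power2_eq_square delta_mult algebra_simps)
  hence "\<delta> c2 = - 24 * \<gamma> * M * \<delta> \<sigma> / \<sigma> ^ 4"
    unfolding c2 using sigma gamma
    by (simp add: delta_divide delta_simps delta_M field_simps eval_nat_numeral)
  thus ?thesis
    unfolding c2 delta_sigma unfolding c1_def using sigma gamma
    by (simp add: field_simps eval_nat_numeral)
qed

end

end

section \<open>The system in the charts at infinity and its three cascades\<close>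

locale system_XIII = XIII_coefficients \<delta> \<beta> \<gamma> q X
  for \<delta> :: "'k::{field_gcd, field_char_0} \<Rightarrow> 'k" and \<beta> \<gamma> q X
begin

definition "XIII =
  (cst \<sigma> - cst \<beta> * var_y\<^sup>2 + 3 * cst \<gamma> * var_y * var_z + 4 * var_y * cst q,
   var_z * (cst \<beta> * var_y - cst \<gamma> * var_z - 2 * cst q))"

lemma cst_nz [simp]: "cst \<beta> \<noteq> 0" "cst \<gamma> \<noteq> 0"
  using beta gamma by simp_all

definition "S_u0v0 = (cst \<beta> - 3 * cst \<gamma> * var_z - 4 * cst q * var_y - cst \<sigma> * var_y\<^sup>2,
  (2 * cst \<beta> * var_z - 4 * cst \<gamma> * var_z\<^sup>2 - 6 * cst q * var_y * var_z - cst \<sigma> * var_y\<^sup>2 * var_z)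
    / var_y)"

definition "S_U0V0 = ((4 * cst \<gamma> * var_y - 2 * cst \<beta> * var_y\<^sup>2 + 6 * cst q * var_y * var_z
    + cst \<sigma> * var_z\<^sup>2) / var_z,
  cst \<gamma> - cst \<beta> * var_y + 2 * cst q * var_z)"

lemma chart_u0v0_XIII: "chart_u0v0 XIII = S_u0v0"
  unfolding chart_u0v0_def XIII_def S_u0v0_def Let_def fst_conv snd_conv
    subst_simps[OF dominant_u0v0]
  by (simp add: field_simps power2_eq_square)

lemma chart_U0V0_XIII: "chart_U0V0 XIII = S_U0V0"
  unfolding chart_U0V0_def XIII_def S_U0V0_def Let_def fst_conv snd_conv
    subst_simps[OF dominant_U0V0]
  by (simp add: field_simps power2_eq_square)


text \<open>The quotient of \<open>z0\<close> by \<open>a0\<close> is 2. As \<open>z = 0\<close> is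
  an invariant line of the system, both centres are the origin and \<open>y0 = 0\<close>, so the
  compatibility condition reads 0 = 0.\<close>

lemma resolved_u0v0_origin: "resolved \<delta> S_u0v0 (0, 0)"
proof -
  interpret s0: cascade_step \<delta>
    "cst \<beta> - 3 * cst \<gamma> * var_z - 4 * cst q * var_y - cst \<sigma> * var_y\<^sup>2" 0
    "2 * cst \<beta> - 4 * cst \<gamma> * var_z - 6 * cst q * var_y - cst \<sigma> * var_y\<^sup>2"
    0 \<beta> 0 "2 * \<beta>"
    by standard (simp, (rule has_val_cong, (rule has_val_intros)+, simp)+)
  interpret s1: cascade_step \<delta>
    "cst \<beta> - 3 * cst \<gamma> * var_y * var_z - 4 * cst q * var_y - cst \<sigma> * var_y\<^sup>2" 0
    "cst \<beta> - cst \<gamma> * var_y * var_z - 2 * cst q * var_y"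
    0 \<beta> 0 \<beta>
    by standard (simp, (rule has_val_cong, (rule has_val_intros)+, simp)+)
  have 0: "S_u0v0 = s0.S"
    unfolding s0.S_def S_u0v0_def by (simp add: field_simps power2_eq_square)
  have 1: "blowup_uv \<delta> (0, 0) s0.S = s1.S"
    unfolding s0.blowup_uv_S unfolding s1.S_def s0.pull_uv_simps
    by (simp add: field_simps power2_eq_square)
  show ?thesis
    using s0.resolved_step s1.resolved_final_iff beta unfolding 0 1 by simp
qed

lemma resolved_u0v0_iff: "resolved \<delta> S_u0v0 (0, \<beta> / (2 * \<gamma>)) \<longleftrightarrow> PII_derivative"
proof -
  interpret s0: cascade_step \<delta>
    "cst \<beta> - 3 * cst \<gamma> * var_z - 4 * cst q * var_y - cst \<sigma> * var_y\<^sup>2"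
    "- 6 * cst q * var_z - cst \<sigma> * var_y * var_z" "- 4 * cst \<gamma> * var_z"
    "\<beta> / (2 * \<gamma>)" "- \<beta> / 2" "- 3 * q * \<beta> / \<gamma>" "- 2 * \<beta>"
    by standard (simp, (rule has_val_cong, (rule has_val_intros)+, use gamma in simp)+)
  \<comment> \<open>The terms \<open>- 2 q z - \<gamma> z^2\<close> of \<open>By\<close> are
    \<open>- \<gamma> z (z - b1)\<close>. They vanish at the centre, and \<open>y0\<close> comes
    from \<sigma> alone.\<close>
  interpret s1: cascade_step \<delta>
    "- cst \<beta> / 2 - 3 * cst \<gamma> * var_y * var_z - 4 * cst q * var_y - cst \<sigma> * var_y\<^sup>2"
    "- cst \<sigma> * cst \<beta> / (2 * cst \<gamma>) - 2 * cst q * var_z - cst \<gamma> * var_z\<^sup>2" "- 3 * cst \<beta> / 2"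
    b1 "- \<beta> / 2" "- \<sigma> * \<beta> / (2 * \<gamma>)" "- 3 * \<beta> / 2"
    by standard (simp, (rule has_val_cong, (rule has_val_intros)+,
      use gamma in \<open>simp_all add: b1_def power2_eq_square\<close>)+)
  interpret s2: cascade_step \<delta>
    "- cst \<beta> / 2 + 2 * cst q * var_y - 3 * cst \<gamma> * var_y\<^sup>2 * var_z - cst \<sigma> * var_y\<^sup>2"
    "2 * cst \<gamma> * var_y * var_z\<^sup>2 + cst \<sigma> * var_y * var_z" "- cst \<beta>"
    b2 "- \<beta> / 2" 0 "- \<beta>"
    by standard (simp, (rule has_val_cong, (rule has_val_intros)+, simp_all)+)
  interpret s3: cascade_step \<delta>
    "- cst \<beta> / 2 + 2 * cst q * var_y - 3 * cst \<gamma> * var_y\<^sup>2 * (cst b2 + var_y * var_z)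
      - cst \<sigma> * var_y\<^sup>2"
    "2 * cst \<gamma> * (cst b2 + var_y * var_z)\<^sup>2 + cst \<sigma> * (cst b2 + var_y * var_z) - 2 * cst q * var_z
      + 3 * cst \<gamma> * var_y * var_z * (cst b2 + var_y * var_z) + cst \<sigma> * var_y * var_z"
    "- cst \<beta> / 2"
    b3 "- \<beta> / 2" "2 * \<gamma> * b2\<^sup>2 + \<sigma> * b2 - 2 * q * b3" "- \<beta> / 2"
    by standard (simp, (rule has_val_cong, (rule has_val_intros)+, simp_all)+)
  have 0: "S_u0v0 = s0.S"
    unfolding s0.S_def S_u0v0_def using gamma by (simp add: cst_simps field_simps power2_eq_square)
  have 1: "blowup_uv \<delta> (0, \<beta> / (2 * \<gamma>)) s0.S = s1.S"
    unfolding s0.blowup_uv_S unfolding s1.S_def s0.pull_uv_simps delta_b0 using gamma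
    by (simp add: b1_def cst_simps field_simps power2_eq_square)
  have 2: "blowup_uv \<delta> (0, b1) s1.S = s2.S"
    unfolding s1.blowup_uv_S unfolding s2.S_def s1.pull_uv_simps delta_b1
    using gamma by (simp add: b1_def cst_simps field_simps power2_eq_square)
  have 3: "blowup_uv \<delta> (0, b2) s2.S = s3.S"
    unfolding s2.blowup_uv_S unfolding s3.S_def s2.pull_uv_simps delta_b2
    by (simp add: cst_simps field_simps power2_eq_square)
  have "resolved \<delta> S_u0v0 (0, \<beta> / (2 * \<gamma>)) \<longleftrightarrow> resolved \<delta> s1.S (0, b1)"
    unfolding 0 using s0.resolved_step neq unfolding delta_b0 next_b1 1 by blast
  also have "\<dots> \<longleftrightarrow> resolved \<delta> s2.S (0, b2)"
    using s1.resolved_step neq unfolding next_b2 2 by blast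
  also have "\<dots> \<longleftrightarrow> resolved \<delta> s3.S (0, b3)"
    using s2.resolved_step neq unfolding next_b3 3 by blast
  also have "\<dots> \<longleftrightarrow> \<delta> b3 = 2 * \<gamma> * b2\<^sup>2 + \<sigma> * b2 - 2 * q * b3"
    using s3.resolved_final_iff neq by blast
  also have "\<dots> \<longleftrightarrow> PII_derivative"
    by (rule resonance_uv_iff)
  finally show ?thesis .
qed

text \<open>Here \<open>y0 = 4 * \<gamma>\<close> and \<open>a0 = \<gamma>\<close>, so four blow-ups
  are again to be expected. One implication suffices, since the necessity of the condition is
  supplied by \<open>resolved_u0v0_iff\<close>.\<close>

lemma resolved_U0V0_origin:
  assumes PII_derivative
  shows "resolved \<delta> S_U0V0 (0, 0)"
proof -
  interpret m0: cascade_step_mirror \<delta>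
    "cst \<gamma> - cst \<beta> * var_y + 2 * cst q * var_z"
    "4 * cst \<gamma> - 2 * cst \<beta> * var_y + 6 * cst q * var_z" "cst \<sigma> * var_z" \<gamma> "4 * \<gamma>" 0
    by standard (simp, (rule has_val_cong, (rule has_val_intros)+, simp_all add: gamma)+)
  interpret m1: cascade_step_mirror \<delta>
    "cst \<gamma> - cst \<beta> * var_y * var_z + 2 * cst q * var_z"
    "3 * cst \<gamma> - cst \<beta> * var_y * var_z + 4 * cst q * var_z" "cst \<sigma>" \<gamma> "3 * \<gamma>" \<sigma>
    by standard (simp, (rule has_val_cong, (rule has_val_intros)+, simp_all add: gamma)+)
  have 0: "S_U0V0 = m0.S"
    unfolding m0.S_def S_U0V0_def by (simp add: field_simps power2_eq_square)
  have 1: "blowup_UV \<delta> (0, 0) m0.S = m1.S"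
    unfolding m0.blowup_UV_S unfolding m1.S_def m0.pull_UV_simps
    by (simp add: field_simps power2_eq_square)
  have *: "resolved \<delta> S_U0V0 (0, 0) \<longleftrightarrow> resolved \<delta> m1.S (0, 0)"
    using m0.resolved_step_0 gamma unfolding 0 1 by simp
  show ?thesis
  proof (cases "\<sigma> = 0")
    case True
    \<comment> \<open>In this Riccati case, \<open>2 * q\<^sup>2 + 2 * \<delta> q + X = 0\<close>,
      every centre is the origin of the second chart and \<open>Bz\<close> vanishes identically, so
      the last stage imposes no condition.\<close>
    interpret m2: cascade_step_mirror \<delta>
      "cst \<gamma> - cst \<beta> * var_y * var_z\<^sup>2 + 2 * cst q * var_z"
      "2 * cst \<gamma> + 2 * cst q * var_z" 0 \<gamma> "2 * \<gamma>" 0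
      by standard (simp, (rule has_val_cong, (rule has_val_intros)+, simp_all add: gamma)+)
    interpret m3: cascade_step_mirror \<delta>
      "cst \<gamma> - cst \<beta> * var_y * var_z ^ 3 + 2 * cst q * var_z"
      "cst \<gamma> + cst \<beta> * var_y * var_z ^ 3" 0 \<gamma> \<gamma> 0
      by standard (simp, (rule has_val_cong, (rule has_val_intros)+, simp_all add: gamma)+)
    have 2: "blowup_UV \<delta> (0, 0) m1.S = m2.S"
      unfolding m1.blowup_UV_S unfolding m2.S_def m1.pull_UV_simps
      by (simp add: True field_simps power2_eq_square)
    have 3: "blowup_UV \<delta> (0, 0) m2.S = m3.S"
      unfolding m2.blowup_UV_S unfolding m3.S_def m2.pull_UV_simps
      by (simp add: field_simps power2_eq_square power3_eq_cube)
    show ?thesis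
      using * m1.resolved_step_0 m2.resolved_step_0 m3.resolved_final True gamma
      unfolding 2 3 by simp
  next
    case False
    note b = c1_neq_0[OF False]
    have sigma_neq: "- \<sigma> \<noteq> 0" "- \<sigma> \<noteq> - \<sigma> / 2" "- \<sigma> / 2 \<noteq> 0"
      using sigma_neq_half[OF False] False by auto
    \<comment> \<open>With \<sigma> expressed through \<open>c1\<close>, the identities between
      successive stages hold for free parameters.\<close>
    have csig: "cst \<sigma> = - 2 * cst \<gamma> / cst c1"
      by (subst sigma_eq[OF False]) (simp add: cst_simps)
    have nz: "cst c1 + var_y * var_z \<noteq> 0"
    proof
      assume "cst c1 + var_y * var_z = 0"
      moreover have "has_val (cst c1 + var_y * var_z) (0, 0) c1"
        by (rule has_val_cong, (rule has_val_intros)+) simp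
      ultimately show False
        using b has_val_unique has_val_0 by metis
    qed
    \<comment> \<open>The cascade has moved to the point \<open>(0, c1)\<close> of the first chart.
      The denominator \<open>var_z\<close> is a unit there, so \<open>A\<close> has a value although
      it is not a polynomial.\<close>
    interpret n0: cascade_step \<delta>
      "(3 * cst \<gamma> - cst \<beta> * var_y\<^sup>2 * var_z + 4 * cst q * var_y * var_z + cst \<sigma> * var_z) / var_z"
      "- 2 * cst q * var_z" "- cst \<sigma>"
      c1 "- \<sigma> / 2" "- 2 * q * c1" "- \<sigma>"
    proof standard
      show "has_val ((3 * cst \<gamma> - cst \<beta> * var_y\<^sup>2 * var_z + 4 * cst q * var_y * var_z
          + cst \<sigma> * var_z) / var_z) (0, c1) (- \<sigma> / 2)"
        by (rule has_val_cong, (rule has_val_intros)+)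
          (use b eigenvalue_c1[OF False] in simp_all)
    qed (simp, (rule has_val_cong, (rule has_val_intros)+, simp)+)
    interpret n1: cascade_step \<delta>
      "3 * cst \<gamma> / (cst c1 + var_y * var_z) - cst \<beta> * var_y\<^sup>2 + 4 * cst q * var_y + cst \<sigma>"
      "- 6 * cst q * var_z + 3 * cst \<gamma> * var_z\<^sup>2 / (cst c1 * (cst c1 + var_y * var_z))
        + cst \<beta> * var_y * var_z"
      "- cst \<sigma> / 2"
      c2 "- \<sigma> / 2" "- 6 * q * c2 + 3 * \<gamma> * c2\<^sup>2 / c1\<^sup>2" "- \<sigma> / 2"
    proof standard
      show "has_val (3 * cst \<gamma> / (cst c1 + var_y * var_z) - cst \<beta> * var_y\<^sup>2 + 4 * cst q * var_y
          + cst \<sigma>) (0, c2) (- \<sigma> / 2)"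
        by (rule has_val_cong, (rule has_val_intros | (simp add: b; fail))+)
          (use b eigenvalue_c1[OF False] in simp_all)
      show "has_val (- 6 * cst q * var_z
          + 3 * cst \<gamma> * var_z\<^sup>2 / (cst c1 * (cst c1 + var_y * var_z))
          + cst \<beta> * var_y * var_z) (0, c2) (- 6 * q * c2 + 3 * \<gamma> * c2\<^sup>2 / c1\<^sup>2)"
        by (rule has_val_cong, (rule has_val_intros | (simp add: b; fail))+)
          (use b in \<open>simp_all add: power2_eq_square\<close>)
    qed (simp, (rule has_val_cong, (rule has_val_intros)+, simp_all)+)
    have 2: "blowup_uv \<delta> (0, 0) m1.S = n0.S"
      unfolding m1.blowup_uv_S unfolding n0.S_def m1.pull_uv_simps
      using b by (simp add: csig field_simps power2_eq_square)
    have 3: "blowup_uv \<delta> (0, c1) n0.S = n1.S"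
      unfolding n0.blowup_uv_S unfolding n1.S_def n0.pull_uv_simps delta_c1[OF False]
    proof (intro arg_cong2[where f = Pair] arg_cong[where f = "\<lambda>h. h / var_y"])
      show A: "(3 * cst \<gamma> - cst \<beta> * (cst 0 + var_y)\<^sup>2 * (cst c1 + var_y * var_z)
            + 4 * cst q * (cst 0 + var_y) * (cst c1 + var_y * var_z)
            + cst \<sigma> * (cst c1 + var_y * var_z)) / (cst c1 + var_y * var_z) =
          3 * cst \<gamma> / (cst c1 + var_y * var_z) - cst \<beta> * var_y\<^sup>2 + 4 * cst q * var_y + cst \<sigma>"
        using nz by (simp add: add_divide_distrib diff_divide_distrib)
      \<comment> \<open>A partial fraction decomposition: the difference of the two fractions
        contains the factor \<open>var_y\<close>, which is what \<open>By\<close> of the next stage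
        requires.\<close>
      have split: "var_y * (3 * cst \<gamma> * var_z\<^sup>2 / (cst c1 * (cst c1 + var_y * var_z))) =
          3 * cst \<gamma> * var_z / cst c1 - 3 * cst \<gamma> * var_z / (cst c1 + var_y * var_z)"
        using nz b by (simp add: diff_frac_eq power2_eq_square algebra_simps)
      show "- 2 * cst q * (cst c1 + var_y * var_z) + var_z * - cst \<sigma>
          - cst (\<gamma> * c2 / c1 - 2 * q * c1)
          - var_z * ((3 * cst \<gamma> - cst \<beta> * (cst 0 + var_y)\<^sup>2 * (cst c1 + var_y * var_z)
            + 4 * cst q * (cst 0 + var_y) * (cst c1 + var_y * var_z)
            + cst \<sigma> * (cst c1 + var_y * var_z)) / (cst c1 + var_y * var_z)) =
        var_y * (- 6 * cst q * var_z + 3 * cst \<gamma> * var_z\<^sup>2 / (cst c1 * (cst c1 + var_y * var_z))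
          + cst \<beta> * var_y * var_z) + (var_z - cst c2) * (- cst \<sigma> / 2)"
        unfolding A unfolding distrib_left[of var_y] unfolding split csig using b
        by (simp add: cst_simps algebra_simps add_divide_distrib diff_divide_distrib power2_eq_square)
          (simp add: field_simps)
    qed
    have "resolved \<delta> S_U0V0 (0, 0) \<longleftrightarrow> resolved \<delta> n0.S (0, c1)"
      unfolding * using m1.resolved_step False gamma unfolding next_c1[OF False] 2 by simp
    also have "\<dots> \<longleftrightarrow> resolved \<delta> n1.S (0, c2)"
      using n0.resolved_step sigma_neq unfolding next_c2[OF False] 3 by blast
    also have "\<dots>"
      using n1.resolved_final_iff sigma_neq resonance_UV[OF False assms] by blast
    finally show ?thesis
      by simp
  qed
qed

end


section \<open>Base points in the three charts and the criterion for regularisation\<close>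

context system_XIII
begin

lemma not_base_point_XIII: "\<not> base_point XIII w"
proof -
  have "\<exists>c. has_val (fst XIII) w c"
    unfolding XIII_def fst_conv by (rule exI, (rule has_val_intros)+)
  moreover have "\<exists>c. has_val (snd XIII) w c"
    unfolding XIII_def snd_conv by (rule exI, (rule has_val_intros)+)
  ultimately show ?thesis
    unfolding base_point_def using not_indeterminate_if_val by blast
qed

lemma base_point_u0v0:
  assumes "base_point S_u0v0 (u, v)"
  shows "u = 0" "v = 0 \<or> v = \<beta> / (2 * \<gamma>)"
proof -
  have "\<exists>c. has_val (fst S_u0v0) (u, v) c"
    unfolding S_u0v0_def fst_conv by (rule exI, (rule has_val_intros)+)
  hence "indeterminate_at (snd S_u0v0) (u, v)"
    using assms not_indeterminate_if_val unfolding base_point_def by blast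
  moreover have "has_val (2 * cst \<beta> * var_z - 4 * cst \<gamma> * var_z\<^sup>2 - 6 * cst q * var_y * var_z
      - cst \<sigma> * var_y\<^sup>2 * var_z) (u, v)
      (2 * \<beta> * v - 4 * \<gamma> * v\<^sup>2 - 6 * q * u * v - \<sigma> * u\<^sup>2 * v)"
    by (rule has_val_cong, (rule has_val_intros)+) simp
  ultimately have *: "u = 0 \<and> 2 * \<beta> * v - 4 * \<gamma> * v\<^sup>2 - 6 * q * u * v - \<sigma> * u\<^sup>2 * v = 0"
    unfolding S_u0v0_def snd_conv using not_indeterminate_divide[OF _ has_val_var_y] by fastforce
  thus "u = 0"
    by simp
  with * have "v * (\<beta> - 2 * \<gamma> * v) = 0"
    by (simp add: power2_eq_square algebra_simps)
  thus "v = 0 \<or> v = \<beta> / (2 * \<gamma>)"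
    using gamma by (auto simp: field_simps)
qed

text \<open>Serves both directions of the criterion: necessity is read off at this point, and the
  base point of the chart \<open>(U\<^sub>0, V\<^sub>0)\<close> outside its origin is this same
  point, hence is not treated again.\<close>

lemma base_point_u0v0_nonzero: "base_point S_u0v0 (0, \<beta> / (2 * \<gamma>))"
proof -
  have "indeterminate_at (((var_y - cst 0) * (- 6 * cst q * var_z - cst \<sigma> * var_y * var_z)
      + (var_z - cst (\<beta> / (2 * \<gamma>))) * (- 4 * cst \<gamma> * var_z))
      / ((var_y - cst 0) * 1 + (var_z - cst (\<beta> / (2 * \<gamma>))) * 0)) (0, \<beta> / (2 * \<gamma>))"
    by (rule indeterminate_divide, (rule has_val_intros)+) (use beta gamma in simp)
  moreover have "snd S_u0v0 = ((var_y - cst 0) * (- 6 * cst q * var_z - cst \<sigma> * var_y * var_z)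
      + (var_z - cst (\<beta> / (2 * \<gamma>))) * (- 4 * cst \<gamma> * var_z))
      / ((var_y - cst 0) * 1 + (var_z - cst (\<beta> / (2 * \<gamma>))) * 0)"
    unfolding S_u0v0_def using gamma by (simp add: cst_simps field_simps power2_eq_square)
  ultimately show ?thesis
    unfolding base_point_def by simp
qed

lemma base_point_U0V0:
  assumes "base_point S_U0V0 (u, v)"
  shows "v = 0" "u = 0 \<or> 1 / u = \<beta> / (2 * \<gamma>)"
proof -
  have "\<exists>c. has_val (snd S_U0V0) (u, v) c"
    unfolding S_U0V0_def snd_conv by (rule exI, (rule has_val_intros)+)
  hence "indeterminate_at (fst S_U0V0) (u, v)"
    using assms not_indeterminate_if_val unfolding base_point_def by blast
  moreover have "has_val (4 * cst \<gamma> * var_y - 2 * cst \<beta> * var_y\<^sup>2 + 6 * cst q * var_y * var_z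
      + cst \<sigma> * var_z\<^sup>2) (u, v) (4 * \<gamma> * u - 2 * \<beta> * u\<^sup>2 + 6 * q * u * v + \<sigma> * v\<^sup>2)"
    by (rule has_val_cong, (rule has_val_intros)+) simp
  ultimately have *: "v = 0 \<and> 4 * \<gamma> * u - 2 * \<beta> * u\<^sup>2 + 6 * q * u * v + \<sigma> * v\<^sup>2 = 0"
    unfolding S_U0V0_def fst_conv using not_indeterminate_divide[OF _ has_val_var_z] by fastforce
  thus "v = 0"
    by simp
  with * have "u * (2 * \<gamma> - \<beta> * u) = 0"
    by (simp add: power2_eq_square algebra_simps)
  thus "u = 0 \<or> 1 / u = \<beta> / (2 * \<gamma>)"
    using beta gamma by (cases "u = 0") (simp_all add: frac_eq_eq)
qed

lemma regularised_XIII_iff: "regularised \<delta> XIII \<longleftrightarrow> PII_derivative"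
proof
  assume "regularised \<delta> XIII"
  hence "resolved \<delta> S_u0v0 (0, \<beta> / (2 * \<gamma>))"
    using base_point_u0v0_nonzero unfolding regularised_def chart_u0v0_XIII by blast
  thus PII_derivative
    using resolved_u0v0_iff by simp
next
  assume P: PII_derivative
  show "regularised \<delta> XIII"
    unfolding regularised_def chart_u0v0_XIII chart_U0V0_XIII
  proof (intro conjI allI impI)
    fix w
    assume "base_point XIII w"
    thus "resolved \<delta> XIII w"
      using not_base_point_XIII by blast
  next
    fix u v
    assume "base_point S_u0v0 (u, v) \<and> \<not> (u \<noteq> 0 \<and> base_point XIII (1 / u, v / u))"
    thus "resolved \<delta> S_u0v0 (u, v)"
      using base_point_u0v0 resolved_u0v0_origin resolved_u0v0_iff P by metis
  next
    fix u v
    assume *: "base_point S_U0V0 (u, v) \<and> \<not> (v \<noteq> 0 \<and> base_point XIII (u / v, 1 / v)) \<and>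
      \<not> (u \<noteq> 0 \<and> base_point S_u0v0 (v / u, 1 / u))"
    hence "v = 0" "u = 0"
      using base_point_U0V0[of u v] base_point_u0v0_nonzero by auto
    thus "resolved \<delta> S_U0V0 (u, v)"
      using resolved_U0V0_origin[OF P] by simp
  qed
qed

end


subsection \<open>Birational equivalence\<close>

text \<open>Substituting the variables for themselves turns a polynomial given by its coefficients
  into an expression in \<open>var_y\<close> and \<open>var_z\<close>, to which ordinary algebra
  applies.\<close>

lemma Fract_eq_poly_subst: "Fract p 1 = poly_subst p var_y var_z"
proof (induction p)
  case 0
  show ?case by (simp add: Zero_fract_def)
next
  case (pCons c p)
  have inner: "Fract [:c:] 1 = inner_subst c var_y" for c :: "'a poly"
  proof (induction c)
    case 0
    show ?case by (simp add: Zero_fract_def)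
  next
    case (pCons k c)
    have "[:pCons k c:] = [:[:k:]:] + [:[:0, 1:]:] * [:c:]"
      by simp
    hence "Fract [:pCons k c:] 1 = cst k + var_y * Fract [:c:] 1"
      by (simp only: cst_def var_y_def mult_fract add_fract) simp
    thus ?case
      by (simp add: inner_subst_pCons pCons)
  qed
  have "pCons c p = [:c:] + [:0, 1:] * p"
    by simp
  hence "Fract (pCons c p) 1 = Fract [:c:] 1 + var_z * Fract p 1"
    by (simp only: var_z_def mult_fract add_fract) simp
  thus ?case
    by (simp add: poly_subst_pCons inner pCons)
qed

lemma Fract_eq_divide: "Fract n d = poly_subst n var_y var_z / poly_subst d var_y var_z"
proof -
  have "Fract n d = Fract n 1 / Fract d 1"
    by (simp add: divide_inverse)
  thus ?thesis
    by (simp add: Fract_eq_poly_subst)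
qed

lemmas ratfun_of_poly = Fract_eq_divide poly_subst_pCons inner_subst_pCons

lemma var_y_minus_cst_neq_0: "var_y - cst q \<noteq> 0"
proof
  assume 0: "var_y - cst q = 0"
  have "has_val (var_y - cst q) (q + 1, 0) 1"
    by (rule has_val_cong, (rule has_val_intros)+) simp
  thus False
    unfolding 0 using has_val_unique[OF _ has_val_0] by fastforce
qed

locale subfield =
  fixes M :: "'k::field set"
  assumes zero [intro, simp]: "0 \<in> M" and one [intro, simp]: "1 \<in> M"
    and add [intro]: "a \<in> M \<Longrightarrow> b \<in> M \<Longrightarrow> a + b \<in> M"
    and minus [intro]: "a \<in> M \<Longrightarrow> - a \<in> M"
    and mult [intro]: "a \<in> M \<Longrightarrow> b \<in> M \<Longrightarrow> a * b \<in> M"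
    and divide [intro]: "a \<in> M \<Longrightarrow> b \<in> M \<Longrightarrow> a / b \<in> M"
begin

lemma numeral [intro, simp]: "numeral n \<in> M"
  by (induction n) (simp_all only: numeral.simps one add)

lemma power2 [intro]: "a \<in> M \<Longrightarrow> a\<^sup>2 \<in> M"
  by (auto simp: power2_eq_square)

end

text \<open>The left side is the first component of XIII at \<open>y = N/(B d)\<close>,
  \<open>z = d/G\<close>; the next lemma is the quotient rule for \<open>N/(B d)\<close>. With the
  denominator \<open>B d^2\<close> in both, the comparison reduces to polynomial numerators.\<close>

lemma common_denominator:
  fixes B G d N S Q :: "'a::field"
  assumes "B \<noteq> 0" "G \<noteq> 0" "d \<noteq> 0"
  shows "S / B - B * (N / (B * d))\<^sup>2 + 3 * G * (N / (B * d)) * (d / G) + 4 * (N / (B * d)) * Q =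
    (S * d\<^sup>2 - N\<^sup>2 + 3 * N * d\<^sup>2 + 4 * N * Q * d) / (B * d\<^sup>2)"
  using assms by (simp add: field_simps power2_eq_square)

lemma common_denominator':
  fixes B d N T E :: "'a::field"
  assumes "B \<noteq> 0" "d \<noteq> 0"
  shows "(T * (B * d) - N * (B * E)) / (B * d)\<^sup>2 = (T * d - N * E) / (B * d\<^sup>2)"
  using assms by (simp add: field_simps power2_eq_square)

context system_XIII
begin

lemma XIII_eq_Fract:
  "fst XIII = Fract [:[:\<sigma>, 4 * q, - \<beta>:], [:0, 3 * \<gamma>:]:] 1"
  "snd XIII = Fract [:0, [:- 2 * q, \<beta>:], [:- \<gamma>:]:] 1"
  by (simp_all add: XIII_def ratfun_of_poly poly_subst_base cst_simps algebra_simps power2_eq_square)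

lemma coeffs_in_XIII:
  assumes "subfield M" and "\<beta> \<in> M" "\<gamma> \<in> M" "q \<in> M" "X \<in> M" "\<delta> q \<in> M"
  shows "coeffs_in M (fst XIII)" "coeffs_in M (snd XIII)"
proof -
  interpret subfield M by fact
  have \<sigma>: "\<sigma> \<in> M"
    unfolding \<sigma>_def by (intro divide add mult power2 numeral assms)
  show "coeffs_in M (fst XIII)"
    unfolding coeffs_in_def XIII_eq_Fract using assms \<sigma>
    by (intro exI conjI, rule_tac [2] refl) (auto simp: coeff_pCons one_pCons split: nat.split)
  show "coeffs_in M (snd XIII)"
    unfolding coeffs_in_def XIII_eq_Fract using assms
    by (intro exI conjI, rule_tac [2] refl) (auto simp: coeff_pCons one_pCons split: nat.split)
qed

text \<open>Put \<open>z = (\<eta> - q)/\<gamma>\<close> for a second solution \<open>\<eta>\<close> of PII. The second equation of XIII then forces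
  \<open>\<beta> y = z'/z + \<gamma> z + 2 q\<close>, which is \<open>(\<zeta> - q' - q\<^sup>2 - x/2)/(\<eta> - q)\<close> with \<open>\<zeta> = \<eta>' + \<eta>\<^sup>2 + x/2\<close>.\<close>

lemma birationally_equivalent_XIII:
  assumes "subfield M" and "\<beta> \<in> M" "\<gamma> \<in> M" "q \<in> M" "X \<in> M" "\<delta> q \<in> M"
    and PII: "\<delta> (\<delta> q) = 2 * q ^ 3 + X * q + \<alpha>"
  shows "birationally_equivalent \<delta> M XIII
    (var_z - var_y\<^sup>2 - cst (X / 2), 2 * var_y * var_z + cst (\<alpha> + 1 / 2))"

proof -
  let ?T = "(var_z - var_y\<^sup>2 - cst (X / 2), 2 * var_y * var_z + cst (\<alpha> + 1 / 2)) :: 'k system"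
  interpret subfield M by fact
  \<comment> \<open>\<open>h\<close> absorbs the factor 1/2, so that the identities to be checked in
    \<eta> and \<zeta> become polynomial.\<close>
  define h where "h = X / 2"
  have X: "X = 2 * h" and delta_h: "\<delta> h = 1 / 2"
    by (simp_all add: h_def delta_divide_const delta_X)
  have h: "h \<in> M"
    unfolding h_def by (intro divide numeral assms)
  define r where "r = q\<^sup>2 + \<delta> q + h"
  have \<sigma>: "\<sigma> = 2 * r / \<beta>"
    unfolding \<sigma>_def r_def by (simp add: X algebra_simps)
  have r: "r \<in> M"
    unfolding r_def by (intro add power2 assms h)
  \<comment> \<open>This is where PII enters: it replaces the second derivative of \<open>q\<close>
    in the derivative of \<open>r\<close>, which gives
    \<open>\<delta> r = 2 q r + \<alpha> + 1 / 2\<close>.\<close>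
  have delta_r: "\<delta> r = 2 * q * \<delta> q + 2 * q ^ 3 + 2 * h * q + (\<alpha> + 1 / 2)"
    by (simp add: r_def delta_simps PII delta_h X algebra_simps)
  define n1 d1 n2 d2 where "n1 = [:[:- r:], 1:]" and "d1 = [:[:- \<beta> * q, \<beta>:]:]"
    and "n2 = [:[:- q, 1:]:]" and "d2 = [:[:\<gamma>:]:]"
  define f where "f = (var_z - cst r) / (cst \<beta> * (var_y - cst q))"
  define g where "g = (var_y - cst q) / cst \<gamma>"
  define f' where "f' = cst q + cst \<gamma> * var_z"
  define g' where "g' = cst r + cst \<beta> * cst \<gamma> * var_y * var_z"
  have f_eq: "f = Fract n1 d1" and d1: "d1 \<noteq> 0"
    using beta by (simp_all add: f_def n1_def d1_def ratfun_of_poly poly_subst_base cst_simps algebra_simps)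
  have g_eq: "g = Fract n2 d2" and d2: "d2 \<noteq> 0"
    using gamma by (simp_all add: g_def n2_def d2_def ratfun_of_poly poly_subst_base cst_simps algebra_simps)
  have f'_eq: "f' = Fract [:[:q:], [:\<gamma>:]:] 1" and g'_eq: "g' = Fract [:[:r:], [:0, \<beta> * \<gamma>:]:] 1"
    by (simp_all add: f'_def g'_def ratfun_of_poly poly_subst_base cst_simps algebra_simps)
  have coeffs: "coeffs_in M f" "coeffs_in M g" "coeffs_in M f'" "coeffs_in M g'"
  proof -
    show "coeffs_in M f"
      unfolding coeffs_in_def
      by (rule exI[of _ n1], rule exI[of _ d1])
        (use assms r d1 in \<open>auto simp: f_eq n1_def d1_def coeff_pCons one_pCons split: nat.split\<close>)
    show "coeffs_in M g"
      unfolding coeffs_in_def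
      by (rule exI[of _ n2], rule exI[of _ d2])
        (use assms d2 in \<open>auto simp: g_eq n2_def d2_def coeff_pCons one_pCons split: nat.split\<close>)
    show "coeffs_in M f'" "coeffs_in M g'"
      unfolding coeffs_in_def f'_eq g'_eq using assms r
      by (intro exI conjI, rule_tac [2] refl,
        auto simp: coeff_pCons one_pCons split: nat.split)+
  qed
  have nz: "var_y - cst q \<noteq> 0"
    by (rule var_y_minus_cst_neq_0)
  have "is_subst f f' g' ((g' - cst r) / (cst \<beta> * (f' - cst q)))"
    unfolding f_def by (intro is_subst_intros) (use beta gamma in \<open>simp add: f'_def\<close>)
  hence 1: "is_subst f f' g' var_y"
    using beta gamma by (simp add: f'_def g'_def field_simps)
  have "is_subst g f' g' ((f' - cst q) / cst \<gamma>)"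
    unfolding g_def by (intro is_subst_intros) (use gamma in simp)
  hence 2: "is_subst g f' g' var_z"
    using gamma by (simp add: f'_def)
  have "is_subst f' f g (cst q + cst \<gamma> * g)"
    unfolding f'_def by (intro is_subst_intros)
  hence 3: "is_subst f' f g var_y"
    using gamma by (simp add: g_def)
  have "is_subst g' f g (cst r + cst \<beta> * cst \<gamma> * f * g)"
    unfolding g'_def by (intro is_subst_intros)
  hence 4: "is_subst g' f g var_z"
    using nz beta gamma by (simp add: f_def g_def)
  have td: "poly_total_deriv \<delta> ?T n1 = 2 * var_y * var_z + cst (\<alpha> + 1 / 2 - \<delta> r)"
    "poly_total_deriv \<delta> ?T d1 = cst \<beta> * (var_z - var_y\<^sup>2 - cst h - cst (\<delta> q))"
    "poly_total_deriv \<delta> ?T n2 = var_z - var_y\<^sup>2 - cst h - cst (\<delta> q)"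
    "poly_total_deriv \<delta> ?T d2 = 0"
    unfolding poly_total_deriv_def n1_def d1_def n2_def d2_def Fract_eq_poly_subst h_def[symmetric]
    using beta gamma
    by (simp_all add: map_poly_pCons pderiv_pCons poly_subst_pCons inner_subst_pCons
      poly_subst_base one_pCons delta_simps cst_simps algebra_simps)
  have vals: "Fract d1 1 = cst \<beta> * (var_y - cst q)" "Fract n1 1 = var_z - cst r"
    "Fract d2 1 = cst \<gamma>" "Fract n2 1 = var_y - cst q"
    by (simp_all add: n1_def d1_def n2_def d2_def ratfun_of_poly poly_subst_base cst_simps algebra_simps)
  \<comment> \<open>Coordinates centred at \<open>(q, r)\<close>, in which the denominators of
    \<open>f\<close> and of its derivative are monomials up to constants.\<close>
  define d N where "d = var_y - cst q" and "N = var_z - cst r"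
  note nz = nz[folded d_def]
  have y: "var_y = d + cst q" and z: "var_z = N + cst r"
    by (simp_all add: d_def N_def)
  have 5: "\<exists>r. is_total_deriv \<delta> ?T f r \<and> is_subst (fst XIII) f g r"
  proof (rule exI, rule conjI)
    show "is_subst (fst XIII) f g (cst \<sigma> - cst \<beta> * f\<^sup>2 + 3 * cst \<gamma> * f * g + 4 * f * cst q)"
      unfolding XIII_def fst_conv by (intro is_subst_intros)
    have "cst \<sigma> - cst \<beta> * f\<^sup>2 + 3 * cst \<gamma> * f * g + 4 * f * cst q =
      (poly_total_deriv \<delta> ?T n1 * Fract d1 1 - Fract n1 1 * poly_total_deriv \<delta> ?T d1)
        / (Fract d1 1)\<^sup>2"
    proof -
      have "2 * cst r * d\<^sup>2 - N\<^sup>2 + 3 * N * d\<^sup>2 + 4 * N * cst q * d =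
          (2 * var_y * var_z + cst (\<alpha> + 1 / 2 - \<delta> r)) * d
            - N * (var_z - var_y\<^sup>2 - cst h - cst (\<delta> q))"
        unfolding y z delta_r
        by (simp add: r_def cst_simps algebra_simps power2_eq_square power3_eq_cube)
      thus ?thesis
        unfolding td vals unfolding f_def g_def \<sigma> d_def[symmetric] N_def[symmetric] cst_divide cst_mult
          cst_numeral common_denominator[OF cst_nz nz] common_denominator'[OF cst_nz(1) nz] by simp
    qed
    thus "is_total_deriv \<delta> ?T f (cst \<sigma> - cst \<beta> * f\<^sup>2 + 3 * cst \<gamma> * f * g + 4 * f * cst q)"
      unfolding is_total_deriv_def using d1 f_eq by blast
  qed
  have 6: "\<exists>r. is_total_deriv \<delta> ?T g r \<and> is_subst (snd XIII) f g r"
  proof (rule exI, rule conjI)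
    show "is_subst (snd XIII) f g (g * (cst \<beta> * f - cst \<gamma> * g - 2 * cst q))"
      unfolding XIII_def snd_conv by (intro is_subst_intros)
    have "g * (cst \<beta> * f - cst \<gamma> * g - 2 * cst q) =
      (poly_total_deriv \<delta> ?T n2 * Fract d2 1 - Fract n2 1 * poly_total_deriv \<delta> ?T d2)
        / (Fract d2 1)\<^sup>2"
    proof -
      have "N - d\<^sup>2 - 2 * cst q * d = var_z - var_y\<^sup>2 - cst h - cst (\<delta> q)"
        unfolding y z by (simp add: r_def cst_simps algebra_simps power2_eq_square)
      moreover have "g * (cst \<beta> * f - cst \<gamma> * g - 2 * cst q) = (N - d\<^sup>2 - 2 * cst q * d) / cst \<gamma>"
        unfolding f_def g_def d_def[symmetric] N_def[symmetric] using nz beta gamma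
        by (simp add: field_simps power2_eq_square)
      ultimately show ?thesis
        unfolding td vals using gamma by (simp add: power2_eq_square)
    qed
    thus "is_total_deriv \<delta> ?T g (g * (cst \<beta> * f - cst \<gamma> * g - 2 * cst q))"
      unfolding is_total_deriv_def using d2 g_eq by blast
  qed
  show ?thesis
    unfolding birationally_equivalent_def using coeffs 1 2 3 4 5 6 by blast
qed

end


subsection \<open>Germs of meromorphic functions\<close>

lemma germ_has_laurent_expansion:
  assumes "f meromorphic_on D" "x0 \<in> D"
  shows "(\<lambda>w. f (x0 + w)) has_laurent_expansion laurent_expansion f x0"
  using assms by (rule meromorphic_on_imp_has_laurent_expansion)

lemma laurent_expansion_id: "laurent_expansion (\<lambda>x. x) x0 = germ_x x0"
  unfolding germ_x_def by (intro laurent_expansion_eqI laurent_expansion_intros)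

lemma laurent_expansion_const: "laurent_expansion (\<lambda>_. c) x0 = fls_const c"
  by (intro laurent_expansion_eqI laurent_expansion_intros)

lemma has_laurent_expansion_deriv_shift:
  assumes "(\<lambda>w. f (x0 + w)) has_laurent_expansion F"
  shows "(\<lambda>w. deriv f (x0 + w)) has_laurent_expansion fls_deriv F"
proof -
  have "deriv (\<lambda>w. f (x0 + w)) = (\<lambda>w. deriv f (x0 + w))"
    by (simp add: deriv_shift_0' add_ac o_def fun_eq_iff)
  thus ?thesis
    using has_laurent_expansion_deriv[OF assms] by simp
qed

lemma subfield_mero_germs:
  assumes "x0 \<in> D"
  shows "subfield (mero_germs D x0)"
proof
  show "0 \<in> mero_germs D x0" "1 \<in> mero_germs D x0"
    unfolding mero_germs_def using laurent_expansion_const[of 0] laurent_expansion_const[of 1]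
    by (force intro: meromorphic_intros)+
next
  fix a b assume "a \<in> mero_germs D x0" "b \<in> mero_germs D x0"
  then obtain f g where f: "f meromorphic_on D" "a = laurent_expansion f x0"
    and g: "g meromorphic_on D" "b = laurent_expansion g x0"
    by (auto simp: mero_germs_def)
  note exp = germ_has_laurent_expansion[OF f(1) assms] germ_has_laurent_expansion[OF g(1) assms]
  have "a + b = laurent_expansion (\<lambda>x. f x + g x) x0" "a * b = laurent_expansion (\<lambda>x. f x * g x) x0"
    "a / b = laurent_expansion (\<lambda>x. f x / g x) x0"
    unfolding f g by (intro laurent_expansion_eqI[symmetric] laurent_expansion_intros exp)+
  thus "a + b \<in> mero_germs D x0" "a * b \<in> mero_germs D x0" "a / b \<in> mero_germs D x0"
    unfolding mero_germs_def using f(1) g(1) by (blast intro: meromorphic_intros)+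
next
  fix a assume "a \<in> mero_germs D x0"
  then obtain f where f: "f meromorphic_on D" "a = laurent_expansion f x0"
    by (auto simp: mero_germs_def)
  have "- a = laurent_expansion (\<lambda>x. - f x) x0"
    unfolding f by (intro laurent_expansion_eqI[symmetric] laurent_expansion_intros
      germ_has_laurent_expansion[OF f(1) assms])
  thus "- a \<in> mero_germs D x0"
    unfolding mero_germs_def using f(1) by (blast intro: meromorphic_intros)
qed

lemma in_mero_germs:
  assumes "x0 \<in> D"
  shows "fls_const c \<in> mero_germs D x0" "germ_x x0 \<in> mero_germs D x0"
    and "f meromorphic_on D \<Longrightarrow> laurent_expansion f x0 \<in> mero_germs D x0"
    and "f meromorphic_on D \<Longrightarrow> fls_deriv (laurent_expansion f x0) \<in> mero_germs D x0"
proof -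
  have "fls_const c = laurent_expansion (\<lambda>_. c) x0" "germ_x x0 = laurent_expansion (\<lambda>x. x) x0"
    by (simp_all add: laurent_expansion_const laurent_expansion_id)
  thus "fls_const c \<in> mero_germs D x0" "germ_x x0 \<in> mero_germs D x0"
    unfolding mero_germs_def by (blast intro: meromorphic_intros)+
  assume f: "f meromorphic_on D"
  thus "laurent_expansion f x0 \<in> mero_germs D x0"
    unfolding mero_germs_def by blast
  have "laurent_expansion (deriv f) x0 = fls_deriv (laurent_expansion f x0)"
    by (intro laurent_expansion_eqI has_laurent_expansion_deriv_shift
      germ_has_laurent_expansion[OF f assms])
  moreover have "deriv f meromorphic_on D"
    using f by (intro meromorphic_intros)
  ultimately show "fls_deriv (laurent_expansion f x0) \<in> mero_germs D x0"
    unfolding mero_germs_def by (metis (mono_tags, lifting) mem_Collect_eq)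
qed

text \<open>The equation is assumed only where \<open>q\<close> is analytic. Singularities of
  \<open>q\<close> are isolated, so it holds in a punctured neighbourhood of \<open>x0\<close>, and
  that determines the Laurent series even when \<open>x0\<close> is a pole.\<close>

lemma PII_germ:
  assumes "PII_transcendent D \<alpha> q" "open D" "x0 \<in> D"
  defines "F \<equiv> laurent_expansion q x0"
  shows "fls_deriv (fls_deriv F) = 2 * F ^ 3 + germ_x x0 * F + fls_const \<alpha>"
proof -
  have q: "q meromorphic_on D"
    using assms(1) by (simp add: PII_transcendent_def)
  have F: "(\<lambda>w. q (x0 + w)) has_laurent_expansion F"
    unfolding F_def using q assms(3) by (rule germ_has_laurent_expansion)
  have "isolated_singularity_at q x0"
    using q assms(3) by (auto simp: meromorphic_on_altdef)
  then obtain r where r: "r > 0" "q analytic_on ball x0 r - {x0}"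
    unfolding isolated_singularity_at_def by blast
  have "\<forall>\<^sub>F x in at x0. x \<in> D \<inter> ball x0 r - {x0}"
    using assms r by (intro eventually_at_in_open) auto
  hence "\<forall>\<^sub>F x in at x0. deriv (deriv q) x = 2 * q x ^ 3 + x * q x + \<alpha>"
  proof eventually_elim
    case (elim x)
    hence "q analytic_on {x}"
      using r(2) by (auto intro: analytic_on_subset)
    thus ?case
      using assms(1) elim by (auto simp: PII_transcendent_def)
  qed
  hence "(\<lambda>w. deriv (deriv q) (x0 + w)) has_laurent_expansion fls_deriv (fls_deriv F) \<longleftrightarrow>
      (\<lambda>w. 2 * q (x0 + w) ^ 3 + (x0 + w) * q (x0 + w) + \<alpha>) has_laurent_expansion
        fls_deriv (fls_deriv F)"
    by (rule has_laurent_expansion_cong') auto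
  hence "(\<lambda>w. 2 * q (x0 + w) ^ 3 + (x0 + w) * q (x0 + w) + \<alpha>) has_laurent_expansion
      fls_deriv (fls_deriv F)"
    using has_laurent_expansion_deriv_shift[OF has_laurent_expansion_deriv_shift[OF F]] by blast
  moreover have "(\<lambda>w. 2 * q (x0 + w) ^ 3 + (x0 + w) * q (x0 + w) + \<alpha>) has_laurent_expansion
      fls_const 2 * F ^ 3 + (fls_const x0 + fls_X) * F + fls_const \<alpha>"
    by (intro laurent_expansion_intros F)
  ultimately have "fls_deriv (fls_deriv F) =
      fls_const 2 * F ^ 3 + (fls_const x0 + fls_X) * F + fls_const \<alpha>"
    by (rule has_laurent_expansion_unique)
  thus ?thesis
    by (simp add: germ_x_def)
qed


subsection \<open>The modified system XIII\<close>

definition PII_derivative_dp :: diff_poly where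
  "PII_derivative_dp = DP_add (DP_jet 3) (DP_add
     (DP_mult (DP_const (- 6)) (DP_mult (DP_mult (DP_jet 0) (DP_jet 0)) (DP_jet 1)))
     (DP_mult (DP_const (- 1)) (DP_add (DP_jet 0) (DP_mult DP_x (DP_jet 1)))))"

text \<open>Outer lists run over the powers of \<open>z\<close>, inner ones over those of
  \<open>y\<close>; \<open>[]\<close> is the zero coefficient of \<open>z^0\<close>. Both
  denominators are 1, so the undetermined function ranges over all meromorphic functions.\<close>

definition XIII_presentation :: "complex \<Rightarrow> complex \<Rightarrow> presentation" where
  "XIII_presentation a1 a2 =
    ([[DP_mult (DP_const (a1 / a2)) (DP_add (DP_mult (DP_const 2) (DP_mult (DP_jet 0) (DP_jet 0)))
         (DP_add (DP_mult (DP_const 2) (DP_jet 1)) DP_x)),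
       DP_mult (DP_const 4) (DP_jet 0), DP_const (- a2 / a1)],
      [DP_const 0, DP_const (3 * a1)]],
     [[DP_const 1]],
     [[], [DP_mult (DP_const (- 2)) (DP_jet 0), DP_const (a2 / a1)], [DP_const (- a1)]],
     [[DP_const 1]])"

lemma system_XIII_fls:
  assumes "a1 \<noteq> 0" "a2 \<noteq> 0" "fls_deriv X = 1"
  shows "system_XIII (fls_deriv :: complex fls \<Rightarrow> _) (fls_const (a2 / a1)) (fls_const a1) X"
  using assms by unfold_locales (auto simp: fls_const_nonzero)

context
  fixes a1 a2 :: complex
  assumes a: "a1 \<noteq> 0" "a2 \<noteq> 0"
begin

lemma fls_deriv_germ_x: "fls_deriv (germ_x x0) = 1"
  by (simp add: germ_x_def)

lemma modified_XIII_eq: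
  assumes "fls_deriv X = 1"
  shows "modified_XIII a1 a2 X q = system_XIII.XIII fls_deriv (fls_const (a2 / a1)) (fls_const a1) q X"
proof -
  interpret system_XIII fls_deriv "fls_const (a2 / a1)" "fls_const a1" q X
    using a assms by (rule system_XIII_fls)
  have "fls_const (a1 / a2) * fls_const (a2 / a1) = 1"
    using a by (simp add: fls_const_mult_const)
  hence inv: "fls_const (a1 / a2) = 1 / fls_const (a2 / a1)"
    using beta(1) by (simp add: field_simps)
  show ?thesis
    unfolding modified_XIII_def XIII_def Let_def \<sigma>_def inv
    by (simp add: cst_simps field_simps)
qed

lemma presents_XIII: "presents (XIII_presentation a1 a2) (modified_XIII a1 a2)"
proof -
  have three: "fls_const (a1 * 3) = fls_const a1 * 3"
    using fls_const_mult_const[of a1 3] by simp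
  show ?thesis
    unfolding presents_def XIII_presentation_def prod.case modified_XIII_def Let_def dp_poly_def
    by (simp add: three ratfun_of_poly cst_simps algebra_simps power2_eq_square
      del: fls_const_mult_const)
qed

lemma well_defined_XIII: "well_defined (XIII_presentation a1 a2) X q"
  by (simp add: well_defined_def XIII_presentation_def dp_poly_def)

lemma dp_eval_PII_derivative:
  "dp_eval X q PII_derivative_dp =
    fls_deriv (fls_deriv (fls_deriv q)) - (6 * q\<^sup>2 * fls_deriv q + q + X * fls_deriv q)"
  by (simp add: PII_derivative_dp_def eval_nat_numeral algebra_simps)

lemma regularised_modified_XIII_iff:
  assumes "fls_deriv X = 1"
  shows "regularised fls_deriv (modified_XIII a1 a2 X q) \<longleftrightarrow> dp_eval X q PII_derivative_dp = 0"
proof -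
  interpret system_XIII fls_deriv "fls_const (a2 / a1)" "fls_const a1" q X
    using a assms by (rule system_XIII_fls)
  show ?thesis
    unfolding modified_XIII_eq[OF assms] regularised_XIII_iff dp_eval_PII_derivative
      PII_derivative_def by simp
qed

lemma PII_derivative_dp_eq_0:
  assumes "PII_transcendent D \<alpha> r" "open D" "x0 \<in> D"
  shows "dp_eval (germ_x x0) (laurent_expansion r x0) PII_derivative_dp = 0"
  unfolding dp_eval_PII_derivative PII_germ[OF assms]
  by (simp add: fls_deriv_germ_x power3_eq_cube power2_eq_square algebra_simps)

lemma regularising_conditions_XIII:
  assumes "D \<noteq> {}"
  shows "regularising_conditions D (XIII_presentation a1 a2) (modified_XIII a1 a2) {PII_derivative_dp}"
proof -
  obtain x0 where "x0 \<in> D"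
    using assms by blast
  \<comment> \<open>On the constant function 1 the differential polynomial takes the value -1, so
    the condition is a genuine equation.\<close>
  hence "\<not> solves_all D {PII_derivative_dp} (\<lambda>_. 1)"
    by (auto simp: solves_all_def dp_eval_PII_derivative laurent_expansion_const intro!: bexI[of _ x0])
  moreover have "(\<lambda>_. 1) meromorphic_on D"
    by (intro meromorphic_intros)
  ultimately show ?thesis
    unfolding regularising_conditions_def regularised_on_def well_defined_on_def
    using well_defined_XIII regularised_modified_XIII_iff[OF fls_deriv_germ_x]
    by (auto simp: solves_all_def)
qed

lemma birationally_equivalent_modified_XIII:
  assumes "PII_transcendent D \<alpha> q" "open D" "x0 \<in> D"
  shows "birationally_equivalent fls_deriv (mero_germs D x0)
    (modified_XIII a1 a2 (germ_x x0) (laurent_expansion q x0)) (hamiltonian_PII \<alpha> (germ_x x0))"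
proof -
  interpret system_XIII fls_deriv "fls_const (a2 / a1)" "fls_const a1" "laurent_expansion q x0" "germ_x x0"
    using a fls_deriv_germ_x by (rule system_XIII_fls)
  have "fls_const (1 / 2 :: complex) * 2 = 1"
    using fls_const_mult_const[of "1 / 2 :: complex" 2] by simp
  hence half: "fls_const (1 / 2 :: complex) = 1 / 2"
    by (simp add: field_simps)
  have const: "fls_const (\<alpha> + 1 / 2) = fls_const \<alpha> + 1 / 2"
    unfolding half[symmetric] by (rule fls_plus_const[symmetric])
  have q: "q meromorphic_on D"
    using assms(1) by (simp add: PII_transcendent_def)
  show ?thesis
    unfolding modified_XIII_eq[OF fls_deriv_germ_x] hamiltonian_PII_def const
    by (intro birationally_equivalent_XIII subfield_mero_germs in_mero_germs q assms PII_germ[OF assms])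
qed

lemma coeffs_in_modified_XIII:
  assumes "q meromorphic_on D" "x0 \<in> D"
  shows "coeffs_in (mero_germs D x0) (fst (modified_XIII a1 a2 (germ_x x0) (laurent_expansion q x0)))"
    and "coeffs_in (mero_germs D x0) (snd (modified_XIII a1 a2 (germ_x x0) (laurent_expansion q x0)))"
proof -
  interpret system_XIII fls_deriv "fls_const (a2 / a1)" "fls_const a1" "laurent_expansion q x0" "germ_x x0"
    using a fls_deriv_germ_x by (rule system_XIII_fls)
  show "coeffs_in (mero_germs D x0) (fst (modified_XIII a1 a2 (germ_x x0) (laurent_expansion q x0)))"
    "coeffs_in (mero_germs D x0) (snd (modified_XIII a1 a2 (germ_x x0) (laurent_expansion q x0)))"
    unfolding modified_XIII_eq[OF fls_deriv_germ_x]
    by (intro coeffs_in_XIII subfield_mero_germs in_mero_germs assms)+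
qed

end

theorem proposition2p2:
  fixes a1 a2 \<alpha> :: complex and D :: "complex set" and q :: "complex \<Rightarrow> complex"
  assumes "a1 \<noteq> 0" and "a2 \<noteq> 0"
    and "open D" and "connected D" and "D \<noteq> {}"
    and "PII_transcendent D \<alpha> q"
  shows "bureau_guillot_PII D \<alpha> q (modified_XIII a1 a2)"
proof -
  note a = assms(1,2)
  have q: "q meromorphic_on D"
    using assms(6) by (simp add: PII_transcendent_def)
  have "solves_all D {PII_derivative_dp} r" if "PII_transcendent D \<alpha> r" for r
    using PII_derivative_dp_eq_0[OF a that assms(3)] by (simp add: solves_all_def)
  moreover have "well_defined_on (XIII_presentation a1 a2) D q"
    unfolding well_defined_on_def using well_defined_XIII[OF a] by blast
  ultimately have "\<exists>R. presents R (modified_XIII a1 a2) \<and> well_defined_on R D q \<and>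
      (\<exists>C. regularising_conditions D R (modified_XIII a1 a2) C \<and>
        (\<forall>r. PII_transcendent D \<alpha> r \<and> well_defined_on R D r \<longrightarrow> solves_all D C r))"
    using presents_XIII[OF a] regularising_conditions_XIII[OF a assms(5)] by blast
  thus ?thesis
    unfolding bureau_guillot_PII_def
    using birationally_equivalent_modified_XIII[OF a assms(6,3)] coeffs_in_modified_XIII[OF a q]
    by blast
qed

end
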